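(* Let $D\subseteq \mathcal M^d$ be a free domain and let $\phi$ be a graded function defined on $D$. Then $\phi$ is a free holomorphic function on $D$ if and only if $\phi$ is locally approximable by free polynomials, i.e. for each $M\in D$ and each $\epsilon>0$ there exist a free neighbourhood $U$ of $M$ (an open set in the free topology containing $M$) and a free polynomial $p$ such that $\sup_{x\in U\cap D}\|\phi(x)-p(x)\|<\epsilon$.
   Context: $\mathcal M_n$ denotes the $n\times n$ complex matrices and $\mathcal M^d=\bigcup_{n\ge1}\mathcal M_n^d$ (disjoint union of the sets of $d$-tuples of $n\times n$ matrices). A graded function on $D\subseteq\mathcal M^d$ maps each $x\in D\cap\mathcal M_n^d$ to an element of $\mathcal M_n$. A free polynomial in $d$ variables is a finite linear combination of words in noncommuting variables $x^1,\dots,x^d$ (empty word $=1$), evaluated on $d$-tuples of matrices in the obvious way. For a matrix $\delta$ of free polynomials, $G_\delta=\{M\in\mathcal M^d:\|\delta(M)\|<1\}$ is a basic free open set; the free topology on $\mathcal M^d$ is the topology having the sets $G_\delta$ as a basis, and a free domain is a set open in this topology. An nc-set is a set $D\subseteq\mathcal M^d$ closed under direct sums $M_1\oplus M_2$ (componentwise) and under unitary conjugation $U^*MU$; an nc-domain is an nc-set with $D\cap\mathcal M_n^d$ open for all $n$ (each $G_\delta$ is an nc-domain). An nc-function on an nc-domain $D$ is a graded function $\phi$ with $\phi(x\oplus y)=\phi(x)\oplus\phi(y)$ for $x,y\in D$, and $\phi(s^{-1}xs)=s^{-1}\phi(x)s$ whenever $s$ is an invertible $n\times n$ matrix and $x,s^{-1}xs\in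 D\cap\mathcal M_n^d$. A free holomorphic function on a free domain $D$ is a function $\phi$ such that every $M\in D$ lies in some basic free open set $G_\delta\subseteq D$ on which $\phi$ is a bounded nc-function. *)

theory Defs
  imports "HOL-Analysis.Analysis" "Jordan_Normal_Form.Matrix"
begin

type_synonym point = "nat \<times> complex mat list"

definition Md :: "nat \<Rightarrow> point set" where
  "Md d = {(n, xs). n \<ge> 1 \<and> length xs = d \<and> (\<forall>A\<in>set xs. A \<in> carrier_mat n n)}"

definition vnorm :: "complex vec \<Rightarrow> real" where
  "vnorm v = sqrt (\<Sum>i<dim_vec v. (cmod (v $ i))\<^sup>2)"

definition opnorm :: "complex mat \<Rightarrow> real" where
  "opnorm A = Sup {vnorm (A *\<^sub>v v) | v. v \<in> carrier_vec (dim_col A) \<and> vnorm v \<le> 1}"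

text \<open>Free polynomials in d noncommuting variables: finitely supported coefficient
  functions on words (lists of variable indices < d).\<close>
type_synonym fpoly = "nat list \<Rightarrow> complex"

definition free_poly :: "nat \<Rightarrow> fpoly \<Rightarrow> bool" where
  "free_poly d p \<longleftrightarrow> finite {w. p w \<noteq> 0} \<and> (\<forall>w. p w \<noteq> 0 \<longrightarrow> set w \<subseteq> {..<d})"

definition word_eval :: "point \<Rightarrow> nat list \<Rightarrow> complex mat" where
  "word_eval M w = foldr (\<lambda>i A. (snd M ! i) * A) w (1\<^sub>m (fst M))"

definition poly_eval :: "fpoly \<Rightarrow> point \<Rightarrow> complex mat" where
  "poly_eval p M = mat (fst M) (fst M)
     (\<lambda>(i, j). \<Sum>w\<in>{w. p w \<noteq> 0}. p w * (word_eval M w $$ (i, j)))"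

definition pmat_eval :: "nat \<Rightarrow> nat \<Rightarrow> (nat \<Rightarrow> nat \<Rightarrow> fpoly) \<Rightarrow> point \<Rightarrow> complex mat" where
  "pmat_eval r s \<delta> M = (let n = fst M in mat (r * n) (s * n)
     (\<lambda>(i, j). poly_eval (\<delta> (i div n) (j div n)) M $$ (i mod n, j mod n)))"

definition free_pmat :: "nat \<Rightarrow> nat \<Rightarrow> nat \<Rightarrow> (nat \<Rightarrow> nat \<Rightarrow> fpoly) \<Rightarrow> bool" where
  "free_pmat d r s \<delta> \<longleftrightarrow> (\<forall>i<r. \<forall>j<s. free_poly d (\<delta> i j))"

definition G :: "nat \<Rightarrow> nat \<Rightarrow> nat \<Rightarrow> (nat \<Rightarrow> nat \<Rightarrow> fpoly) \<Rightarrow> point set" where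
  "G d r s \<delta> = {M \<in> Md d. opnorm (pmat_eval r s \<delta> M) < 1}"

definition is_basic_free_open :: "nat \<Rightarrow> point set \<Rightarrow> bool" where
  "is_basic_free_open d U \<longleftrightarrow> (\<exists>r s \<delta>. free_pmat d r s \<delta> \<and> U = G d r s \<delta>)"

definition free_open :: "nat \<Rightarrow> point set \<Rightarrow> bool" where
  "free_open d U \<longleftrightarrow> (\<exists>\<B>. (\<forall>B\<in>\<B>. is_basic_free_open d B) \<and> U = \<Union>\<B>)"

definition graded_on :: "point set \<Rightarrow> (point \<Rightarrow> complex mat) \<Rightarrow> bool" where
  "graded_on D \<phi> \<longleftrightarrow> (\<forall>M\<in>D. \<phi> M \<in> carrier_mat (fst M) (fst M))"

definition dsum :: "point \<Rightarrow> point \<Rightarrow> point" where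
  "dsum M N = (fst M + fst N,
     map2 (\<lambda>A B. four_block_mat A (0\<^sub>m (fst M) (fst N)) (0\<^sub>m (fst N) (fst M)) B) (snd M) (snd N))"

definition dsum_mat :: "complex mat \<Rightarrow> complex mat \<Rightarrow> complex mat" where
  "dsum_mat A B = four_block_mat A (0\<^sub>m (dim_row A) (dim_col B)) (0\<^sub>m (dim_row B) (dim_col A)) B"

text \<open>Similarity s^{-1} x s, with t = s^{-1}.\<close>
definition conj_pt :: "complex mat \<Rightarrow> complex mat \<Rightarrow> point \<Rightarrow> point" where
  "conj_pt t s M = (fst M, map (\<lambda>A. t * A * s) (snd M))"

definition nc_function_on :: "point set \<Rightarrow> (point \<Rightarrow> complex mat) \<Rightarrow> bool" where
  "nc_function_on D \<phi> \<longleftrightarrow> graded_on D \<phi>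
     \<and> (\<forall>x\<in>D. \<forall>y\<in>D. dsum x y \<in> D \<longrightarrow> \<phi> (dsum x y) = dsum_mat (\<phi> x) (\<phi> y))
     \<and> (\<forall>x\<in>D. \<forall>s t. s \<in> carrier_mat (fst x) (fst x) \<and> t \<in> carrier_mat (fst x) (fst x)
          \<and> s * t = 1\<^sub>m (fst x) \<and> t * s = 1\<^sub>m (fst x) \<and> conj_pt t s x \<in> D
          \<longrightarrow> \<phi> (conj_pt t s x) = t * \<phi> x * s)"

definition bounded_on :: "point set \<Rightarrow> (point \<Rightarrow> complex mat) \<Rightarrow> bool" where
  "bounded_on D \<phi> \<longleftrightarrow> (\<exists>B. \<forall>x\<in>D. opnorm (\<phi> x) \<le> B)"

definition free_holomorphic :: "nat \<Rightarrow> point set \<Rightarrow> (point \<Rightarrow> complex mat) \<Rightarrow> bool" where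
  "free_holomorphic d D \<phi> \<longleftrightarrow> (\<forall>M\<in>D. \<exists>r s \<delta>. free_pmat d r s \<delta> \<and> M \<in> G d r s \<delta>
     \<and> G d r s \<delta> \<subseteq> D \<and> nc_function_on (G d r s \<delta>) \<phi> \<and> bounded_on (G d r s \<delta>) \<phi>)"

end

theory Submission
  imports Defs
begin

text \<open>If \<open>\<phi>\<close> is approximable, every basic free neighbourhood of \<open>x \<oplus> y\<close> contains \<open>x\<close> and \<open>y\<close>, so
  one free polynomial approximates \<open>\<phi>\<close> simultaneously at \<open>x\<close>, \<open>y\<close> and \<open>x \<oplus> y\<close>; the identities
  that define an nc-function pass from polynomials to \<open>\<phi>\<close>.

  Conversely, let \<open>\<phi>\<close> be a bounded nc-function on \<open>G\<^sub>\<delta> \<ni> M\<close>. Let \<open>y\<close> be left multiplication by \<open>M\<close>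
  on the finite-dimensional algebra generated by \<open>M\<close>, in a basis \<open>P\<^sub>j(M)\<close> orthonormal for the
  Hilbert--Schmidt inner product, so that \<open>\<parallel>\<delta>(y)\<parallel> \<le> \<parallel>\<delta>(M)\<parallel>\<close>. For \<open>x\<close> and a vector \<open>v\<close> put
  \<open>L e\<^sub>j = P\<^sub>j(x) v\<close>. The columns of \<open>\<delta>(x) L - L \<delta>(y)\<close> are values at \<open>x\<close> of finitely many polynomials that
  vanish at \<open>M\<close>, hence they are uniformly small on a free neighbourhood of \<open>M\<close>. Evaluating \<open>\<phi>\<close> at the
  point similar to \<open>x \<oplus> y\<close> with corner \<open>c (x L - L y)\<close>, \<open>c\<close> large, shows that \<open>\<phi>(x) L - L \<phi>(y)\<close> is
  small too. Applied to the coordinate vector of the identity matrix this compares \<open>\<phi>(x) v\<close>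
  with \<open>p(x) v\<close>, where \<open>p\<close> is a combination of the \<open>P\<^sub>j\<close> with coefficients read off from \<open>\<phi>(y)\<close>.\<close>

unbundle no vec_syntax

section \<open>Kernels bounded in the l2 operator norm\<close>

definition cl2 :: "'i set \<Rightarrow> ('i \<Rightarrow> complex) \<Rightarrow> real" where
  "cl2 I f = L2_set (\<lambda>i. cmod (f i)) I"

text \<open>C bounds the operator norm of the matrix K from l2 over J to l2 over I. Arbitrary index
  sets let a matrix of blocks be indexed by pairs (block, position) and be cut along subsets, with
  no arithmetic on \<open>div\<close> and \<open>mod\<close>.\<close>

definition kernel_bound :: "'i set \<Rightarrow> 'j set \<Rightarrow> ('i \<Rightarrow> 'j \<Rightarrow> complex) \<Rightarrow> real \<Rightarrow> bool" where
  "kernel_bound I J K C \<longleftrightarrow> (\<forall>f. cl2 I (\<lambda>i. \<Sum>j\<in>J. K i j * f j) \<le> C * cl2 J f)"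

lemma cl2_nonneg [simp]: "0 \<le> cl2 I f"
  by (simp add: cl2_def)

lemma cl2_square: "(cl2 I f)\<^sup>2 = (\<Sum>i\<in>I. (cmod (f i))\<^sup>2)"
  by (simp add: cl2_def L2_set_def sum_nonneg)

lemma cl2_cong: "I = I' \<Longrightarrow> (\<And>i. i \<in> I' \<Longrightarrow> f i = g i) \<Longrightarrow> cl2 I f = cl2 I' g"
  unfolding cl2_def by (rule L2_set_cong) auto

lemma cl2_add: "cl2 I (\<lambda>i. f i + g i) \<le> cl2 I f + cl2 I g"
proof -
  have "cl2 I (\<lambda>i. f i + g i) \<le> L2_set (\<lambda>i. cmod (f i) + cmod (g i)) I"
    unfolding cl2_def by (rule L2_set_mono) (auto simp: norm_triangle_ineq)
  also have "\<dots> \<le> cl2 I f + cl2 I g"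
    unfolding cl2_def by (rule L2_set_triangle_ineq)
  finally show ?thesis .
qed

lemma cl2_scale: "cl2 I (\<lambda>i. c * f i) = cmod c * cl2 I f"
  unfolding cl2_def by (simp add: norm_mult L2_set_right_distrib)

lemma cl2_sum: "finite J \<Longrightarrow> cl2 I (\<lambda>i. \<Sum>j\<in>J. g i j) \<le> (\<Sum>j\<in>J. cl2 I (\<lambda>i. g i j))"
proof (induction J rule: finite_induct)
  case empty
  then show ?case by (simp add: cl2_def L2_set_0')
next
  case (insert x F)
  then show ?case using cl2_add[of I "\<lambda>i. g i x" "\<lambda>i. \<Sum>j\<in>F. g i j"] by simp
qed

lemma cl2_ge_entry: "finite I \<Longrightarrow> i \<in> I \<Longrightarrow> cmod (f i) \<le> cl2 I f"
  unfolding cl2_def by (rule member_le_L2_set)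

lemma cl2_reindex: "inj_on h J \<Longrightarrow> cl2 (h ` J) f = cl2 J (\<lambda>j. f (h j))"
  unfolding cl2_def L2_set_def by (simp add: sum.reindex)

lemma cl2_mono_set: "finite J \<Longrightarrow> I \<subseteq> J \<Longrightarrow> cl2 I f \<le> cl2 J f"
  unfolding cl2_def L2_set_def by (simp add: sum_mono2)

lemma cl2_Un_square:
  "finite I \<Longrightarrow> finite J \<Longrightarrow> I \<inter> J = {} \<Longrightarrow> (cl2 (I \<union> J) f)\<^sup>2 = (cl2 I f)\<^sup>2 + (cl2 J f)\<^sup>2"
  unfolding cl2_square by (rule sum.union_disjoint)

text \<open>The l2 norm of the block norms is at most their l1 sum. The loss depends only on the
  number of blocks, not on their size.\<close>

lemma cl2_Times_le:
  assumes "finite A"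
  shows "cl2 (A \<times> B) (\<lambda>(a, b). f a b) \<le> (\<Sum>a\<in>A. cl2 B (f a))"
proof -
  have "cl2 (A \<times> B) (\<lambda>(a, b). f a b) = L2_set (\<lambda>a. cl2 B (f a)) A"
    unfolding cl2_def L2_set_def by (simp add: sum_nonneg sum.cartesian_product case_prod_beta')
  also have "\<dots> \<le> (\<Sum>a\<in>A. cl2 B (f a))"
    by (rule L2_set_le_sum) auto
  finally show ?thesis .
qed

lemma kernel_boundD: "kernel_bound I J K C \<Longrightarrow> cl2 I (\<lambda>i. \<Sum>j\<in>J. K i j * f j) \<le> C * cl2 J f"
  by (simp add: kernel_bound_def)

lemma kernel_bound_mono: "kernel_bound I J K C \<Longrightarrow> C \<le> C' \<Longrightarrow> kernel_bound I J K C'"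
  unfolding kernel_bound_def by (meson cl2_nonneg mult_right_mono order_trans)

lemma kernel_bound_cong:
  assumes "\<And>i j. i \<in> I \<Longrightarrow> j \<in> J \<Longrightarrow> K i j = K' i j"
  shows "kernel_bound I J K C \<longleftrightarrow> kernel_bound I J K' C"
proof -
  have "cl2 I (\<lambda>i. \<Sum>j\<in>J. K i j * f j) = cl2 I (\<lambda>i. \<Sum>j\<in>J. K' i j * f j)" for f
    by (rule cl2_cong) (auto intro!: sum.cong simp: assms)
  then show ?thesis by (simp add: kernel_bound_def)
qed

lemma kernel_bound_add:
  assumes "kernel_bound I J K C" "kernel_bound I J K' C'"
  shows "kernel_bound I J (\<lambda>i j. K i j + K' i j) (C + C')"
  unfolding kernel_bound_def
proof
  fix f
  have "cl2 I (\<lambda>i. \<Sum>j\<in>J. (K i j + K' i j) * f j)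
      = cl2 I (\<lambda>i. (\<Sum>j\<in>J. K i j * f j) + (\<Sum>j\<in>J. K' i j * f j))"
    by (simp add: distrib_right sum.distrib)
  also have "\<dots> \<le> C * cl2 J f + C' * cl2 J f"
    by (rule order_trans[OF cl2_add]) (intro add_mono kernel_boundD assms)
  finally show "cl2 I (\<lambda>i. \<Sum>j\<in>J. (K i j + K' i j) * f j) \<le> (C + C') * cl2 J f"
    by (simp add: distrib_right)
qed

lemma kernel_bound_scale:
  assumes "kernel_bound I J K C"
  shows "kernel_bound I J (\<lambda>i j. c * K i j) (cmod c * C)"
  unfolding kernel_bound_def
proof
  fix f
  have "cl2 I (\<lambda>i. \<Sum>j\<in>J. c * K i j * f j) = cmod c * cl2 I (\<lambda>i. \<Sum>j\<in>J. K i j * f j)"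
    by (subst cl2_scale[symmetric]) (simp add: sum_distrib_left mult.assoc)
  also have "\<dots> \<le> cmod c * (C * cl2 J f)"
    by (intro mult_left_mono kernel_boundD[OF assms]) simp
  finally show "cl2 I (\<lambda>i. \<Sum>j\<in>J. c * K i j * f j) \<le> cmod c * C * cl2 J f"
    by simp
qed

text \<open>A submatrix is a compression: vectors on J' are extended by zero to J, and dropping rows
  outside I' only lowers the norm.\<close>

lemma kernel_bound_subset:
  assumes "kernel_bound I J K C" "I' \<subseteq> I" "J' \<subseteq> J" "finite I" "finite J"
  shows "kernel_bound I' J' K C"
  unfolding kernel_bound_def
proof
  fix f :: "'b \<Rightarrow> complex"
  let ?g = "\<lambda>j. if j \<in> J' then f j else 0"
  have s: "(\<Sum>j\<in>J. K i j * ?g j) = (\<Sum>j\<in>J'. K i j * f j)" for i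
    by (rule sum.mono_neutral_cong_right) (use assms in auto)
  have "(cl2 J ?g)\<^sup>2 = (cl2 J' f)\<^sup>2"
    unfolding cl2_square by (rule sum.mono_neutral_cong_right) (use assms in auto)
  then have n: "cl2 J ?g = cl2 J' f"
    by simp
  have "cl2 I' (\<lambda>i. \<Sum>j\<in>J'. K i j * f j) \<le> cl2 I (\<lambda>i. \<Sum>j\<in>J'. K i j * f j)"
    using assms by (intro cl2_mono_set) auto
  also have "\<dots> \<le> C * cl2 J' f"
    using kernel_boundD[OF assms(1), of ?g] by (simp only: s n)
  finally show "cl2 I' (\<lambda>i. \<Sum>j\<in>J'. K i j * f j) \<le> C * cl2 J' f" .
qed

lemma kernel_bound_reindex:
  assumes "inj_on g I" "inj_on h J"
  shows "kernel_bound (g ` I) (h ` J) K C \<longleftrightarrow> kernel_bound I J (\<lambda>i j. K (g i) (h j)) C"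
proof -
  have *: "(cl2 (g ` I) (\<lambda>i. \<Sum>j\<in>h ` J. K i j * f j) \<le> C * cl2 (h ` J) f) \<longleftrightarrow>
      (cl2 I (\<lambda>i. \<Sum>j\<in>J. K (g i) (h j) * f (h j)) \<le> C * cl2 J (\<lambda>j. f (h j)))" for f
    using assms by (simp add: cl2_reindex sum.reindex)
  show ?thesis
  proof
    assume L: "kernel_bound (g ` I) (h ` J) K C"
    show "kernel_bound I J (\<lambda>i j. K (g i) (h j)) C"
      unfolding kernel_bound_def
    proof
      fix f :: "'c \<Rightarrow> complex"
      \<comment> \<open>The equivalence above speaks only of vectors of the form f o h; injectivity
        of h makes every vector on J agree with one of these.\<close>
      let ?f = "\<lambda>j. f (inv_into J h j)"
      have e: "?f (h j) = f j" if "j \<in> J" for j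
        using assms that by simp
      have "cl2 I (\<lambda>i. \<Sum>j\<in>J. K (g i) (h j) * ?f (h j)) \<le> C * cl2 J (\<lambda>j. ?f (h j))"
        by (rule iffD1[OF * kernel_boundD[OF L]])
      moreover have "cl2 J (\<lambda>j. ?f (h j)) = cl2 J f"
        by (rule cl2_cong) (auto simp: e)
      moreover have "(\<lambda>i. \<Sum>j\<in>J. K (g i) (h j) * ?f (h j)) = (\<lambda>i. \<Sum>j\<in>J. K (g i) (h j) * f j)"
        by (auto intro!: sum.cong simp: e)
      ultimately show "cl2 I (\<lambda>i. \<Sum>j\<in>J. K (g i) (h j) * f j) \<le> C * cl2 J f"
        by simp
    qed
  next
    assume R: "kernel_bound I J (\<lambda>i j. K (g i) (h j)) C"
    show "kernel_bound (g ` I) (h ` J) K C"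
      unfolding kernel_bound_def by (intro allI iffD2[OF *] kernel_boundD[OF R])
  qed
qed

text \<open>Each output piece depends only on its own input piece, so by Pythagoras the squares add
  up and the bound stays C. The triangle inequality would give 2 C, which is useless for staying
  below the level 1.\<close>

lemma kernel_bound_block_diag:
  assumes b: "kernel_bound I1 J1 K C" "kernel_bound I2 J2 K C" and C: "0 \<le> C"
    and fin: "finite I1" "finite I2" "finite J1" "finite J2"
    and dj: "I1 \<inter> I2 = {}" "J1 \<inter> J2 = {}"
    and z: "\<And>i j. i \<in> I1 \<Longrightarrow> j \<in> J2 \<Longrightarrow> K i j = 0" "\<And>i j. i \<in> I2 \<Longrightarrow> j \<in> J1 \<Longrightarrow> K i j = 0"
  shows "kernel_bound (I1 \<union> I2) (J1 \<union> J2) K C"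
  unfolding kernel_bound_def
proof
  fix f
  let ?h = "\<lambda>i. \<Sum>j\<in>J1 \<union> J2. K i j * f j"
  have s: "?h i = (\<Sum>j\<in>J1. K i j * f j) + (\<Sum>j\<in>J2. K i j * f j)" for i
    by (rule sum.union_disjoint) (use fin dj in auto)
  have 1: "cl2 I1 ?h = cl2 I1 (\<lambda>i. \<Sum>j\<in>J1. K i j * f j)"
    by (rule cl2_cong) (auto simp: s z)
  have 2: "cl2 I2 ?h = cl2 I2 (\<lambda>i. \<Sum>j\<in>J2. K i j * f j)"
    by (rule cl2_cong) (auto simp: s z)
  have "(cl2 (I1 \<union> I2) ?h)\<^sup>2 = (cl2 I1 ?h)\<^sup>2 + (cl2 I2 ?h)\<^sup>2"
    using fin dj by (rule_tac cl2_Un_square)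
  also have "\<dots> \<le> (C * cl2 J1 f)\<^sup>2 + (C * cl2 J2 f)\<^sup>2"
    unfolding 1 2 by (intro add_mono power_mono kernel_boundD b) auto
  also have "\<dots> = C\<^sup>2 * ((cl2 J1 f)\<^sup>2 + (cl2 J2 f)\<^sup>2)"
    by (simp add: power_mult_distrib distrib_left)
  also have "\<dots> = (C * cl2 (J1 \<union> J2) f)\<^sup>2"
    by (subst cl2_Un_square[symmetric]) (use fin dj in \<open>auto simp: power_mult_distrib\<close>)
  finally show "cl2 (I1 \<union> I2) ?h \<le> C * cl2 (J1 \<union> J2) f"
    by (rule power2_le_imp_le) (simp add: C)
qed

text \<open>A crude bound by the triangle inequality over the columns. It shows that operator norms
  are finite, and it later turns small columns into a small corner block.\<close>

lemma kernel_bound_columns: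
  assumes "finite J"
  shows "kernel_bound I J K (\<Sum>j\<in>J. cl2 I (\<lambda>i. K i j))"
  unfolding kernel_bound_def
proof
  fix f
  have "cl2 I (\<lambda>i. \<Sum>j\<in>J. K i j * f j) \<le> (\<Sum>j\<in>J. cl2 I (\<lambda>i. K i j * f j))"
    by (rule cl2_sum) fact
  also have "\<dots> = (\<Sum>j\<in>J. cmod (f j) * cl2 I (\<lambda>i. K i j))"
    by (subst cl2_scale[symmetric]) (simp add: mult.commute)
  also have "\<dots> \<le> (\<Sum>j\<in>J. cl2 J f * cl2 I (\<lambda>i. K i j))"
    by (intro sum_mono mult_right_mono cl2_ge_entry assms) auto
  finally show "cl2 I (\<lambda>i. \<Sum>j\<in>J. K i j * f j) \<le> (\<Sum>j\<in>J. cl2 I (\<lambda>i. K i j)) * cl2 J f"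
    by (simp add: sum_distrib_left mult.commute)
qed

section \<open>Vector norm and operator norm of matrices in terms of kernels\<close>

lemma vnorm_cl2: "vnorm v = cl2 {..<dim_vec v} (($) v)"
  by (simp add: vnorm_def cl2_def L2_set_def)

lemma vnorm_nonneg [simp]: "0 \<le> vnorm v"
  by (simp add: vnorm_cl2)

lemma vnorm_smult: "vnorm (c \<cdot>\<^sub>v v) = cmod c * vnorm v"
  unfolding vnorm_cl2 by (subst cl2_scale[symmetric]) (auto intro: cl2_cong)

lemma vnorm_mult_mat_vec:
  assumes "v \<in> carrier_vec (dim_col A)"
  shows "vnorm (A *\<^sub>v v) = cl2 {..<dim_row A} (\<lambda>i. \<Sum>j\<in>{..<dim_col A}. A $$ (i, j) * v $ j)"
  unfolding vnorm_cl2 using assms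
  by (intro cl2_cong) (auto simp: scalar_prod_def atLeast0LessThan intro!: sum.cong)

lemma vnorm_bound_iff_kernel_bound:
  "(\<forall>v\<in>carrier_vec (dim_col A). vnorm (A *\<^sub>v v) \<le> C * vnorm v) \<longleftrightarrow>
    kernel_bound {..<dim_row A} {..<dim_col A} (\<lambda>i j. A $$ (i, j)) C"
proof
  assume L: "\<forall>v\<in>carrier_vec (dim_col A). vnorm (A *\<^sub>v v) \<le> C * vnorm v"
  show "kernel_bound {..<dim_row A} {..<dim_col A} (\<lambda>i j. A $$ (i, j)) C"
    unfolding kernel_bound_def
  proof
    fix f :: "nat \<Rightarrow> complex"
    let ?v = "vec (dim_col A) f"
    have "vnorm (A *\<^sub>v ?v) = cl2 {..<dim_row A} (\<lambda>i. \<Sum>j<dim_col A. A $$ (i, j) * f j)"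
      by (subst vnorm_mult_mat_vec) auto
    moreover have "vnorm ?v = cl2 {..<dim_col A} f"
      unfolding vnorm_cl2 by (rule cl2_cong) auto
    ultimately show "cl2 {..<dim_row A} (\<lambda>i. \<Sum>j<dim_col A. A $$ (i, j) * f j) \<le> C * cl2 {..<dim_col A} f"
      using L vec_carrier[of "dim_col A" f] by fastforce
  qed
next
  assume R: "kernel_bound {..<dim_row A} {..<dim_col A} (\<lambda>i j. A $$ (i, j)) C"
  show "\<forall>v\<in>carrier_vec (dim_col A). vnorm (A *\<^sub>v v) \<le> C * vnorm v"
  proof
    fix v :: "complex Matrix.vec" assume v: "v \<in> carrier_vec (dim_col A)"
    then show "vnorm (A *\<^sub>v v) \<le> C * vnorm v"
      using kernel_boundD[OF R, of "($) v"] by (simp add: vnorm_mult_mat_vec vnorm_cl2[of v])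
  qed
qed

text \<open>A real \<open>Sup\<close> is informative only for a set that is bounded above; the crude
  column estimate supplies the bound.\<close>

lemma opnorm_set_bdd:
  "bdd_above {vnorm (A *\<^sub>v v) | v. v \<in> carrier_vec (dim_col A) \<and> vnorm v \<le> 1}"
proof -
  let ?C = "\<Sum>j<dim_col A. cl2 {..<dim_row A} (\<lambda>i. A $$ (i, j))"
  have "vnorm (A *\<^sub>v v) \<le> ?C" if "v \<in> carrier_vec (dim_col A)" "vnorm v \<le> 1" for v
  proof -
    have "vnorm (A *\<^sub>v v) \<le> ?C * vnorm v"
      using that vnorm_bound_iff_kernel_bound[of A ?C] kernel_bound_columns by blast
    also have "\<dots> \<le> ?C * 1"
      by (intro mult_left_mono that sum_nonneg) auto
    finally show ?thesis by simp
  qed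
  then show ?thesis
    unfolding bdd_above_def by blast
qed

lemma vnorm_zero [simp]: "vnorm (0\<^sub>v n) = 0"
  by (simp add: vnorm_def)

lemma opnorm_nonneg [simp]: "0 \<le> opnorm A"
proof -
  have "vnorm (A *\<^sub>v 0\<^sub>v (dim_col A)) \<le> opnorm A"
    unfolding opnorm_def by (rule cSup_upper[OF _ opnorm_set_bdd]) force
  then show ?thesis
    using vnorm_nonneg order_trans by blast
qed

lemma vnorm_eq_0_imp:
  assumes "vnorm v = 0" "v \<in> carrier_vec n" shows "v = 0\<^sub>v n"
proof (rule eq_vecI)
  show "v $ i = 0\<^sub>v n $ i" if "i < dim_vec (0\<^sub>v n)" for i
    using cl2_ge_entry[of "{..<n}" i "($) v"] that assms by (simp add: vnorm_cl2)
qed (use assms in simp)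

lemma vnorm_le_opnorm:
  assumes v: "v \<in> carrier_vec (dim_col A)"
  shows "vnorm (A *\<^sub>v v) \<le> opnorm A * vnorm v"
proof (cases "vnorm v = 0")
  case True
  have "A *\<^sub>v 0\<^sub>v (dim_col A) = 0\<^sub>v (dim_row A)"
    by (intro eq_vecI) (auto simp: scalar_prod_def)
  then show ?thesis using vnorm_eq_0_imp[OF True v] by simp
next
  case False
  define c where "c = complex_of_real (1 / vnorm v)"
  have pos: "vnorm v > 0"
    using False vnorm_nonneg[of v] by linarith
  have "vnorm (A *\<^sub>v (c \<cdot>\<^sub>v v)) \<le> opnorm A"
    unfolding opnorm_def
  proof (rule cSup_upper[OF _ opnorm_set_bdd])
    have "vnorm (c \<cdot>\<^sub>v v) \<le> 1"
      unfolding vnorm_smult c_def using pos by (simp add: norm_divide)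
    then show "vnorm (A *\<^sub>v (c \<cdot>\<^sub>v v)) \<in> {vnorm (A *\<^sub>v v) |v. v \<in> carrier_vec (dim_col A) \<and> vnorm v \<le> 1}"
      using v by auto
  qed
  moreover have "A *\<^sub>v (c \<cdot>\<^sub>v v) = c \<cdot>\<^sub>v (A *\<^sub>v v)"
    using v by (intro mult_mat_vec[of _ "dim_row A" "dim_col A"]) auto
  ultimately show ?thesis
    using pos by (simp add: vnorm_smult c_def norm_divide field_simps)
qed

lemma opnorm_le_iff:
  assumes "0 \<le> C"
  shows "opnorm A \<le> C \<longleftrightarrow> (\<forall>v\<in>carrier_vec (dim_col A). vnorm (A *\<^sub>v v) \<le> C * vnorm v)"
proof
  assume "opnorm A \<le> C"
  then show "\<forall>v\<in>carrier_vec (dim_col A). vnorm (A *\<^sub>v v) \<le> C * vnorm v"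
    by (meson vnorm_le_opnorm vnorm_nonneg mult_right_mono order_trans)
next
  assume R: "\<forall>v\<in>carrier_vec (dim_col A). vnorm (A *\<^sub>v v) \<le> C * vnorm v"
  show "opnorm A \<le> C"
    unfolding opnorm_def
  proof (rule cSup_least)
    show "{vnorm (A *\<^sub>v v) |v. v \<in> carrier_vec (dim_col A) \<and> vnorm v \<le> 1} \<noteq> {}"
      by (auto intro!: exI[of _ "0\<^sub>v (dim_col A)"])
  next
    fix x assume "x \<in> {vnorm (A *\<^sub>v v) |v. v \<in> carrier_vec (dim_col A) \<and> vnorm v \<le> 1}"
    then obtain v where v: "x = vnorm (A *\<^sub>v v)" "v \<in> carrier_vec (dim_col A)" "vnorm v \<le> 1"
      by blast
    then have "x \<le> C * vnorm v" using R by auto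
    also have "\<dots> \<le> C * 1" by (intro mult_left_mono v assms)
    finally show "x \<le> C" by simp
  qed
qed

lemma opnorm_le_iff_kernel_bound:
  "0 \<le> C \<Longrightarrow> opnorm A \<le> C \<longleftrightarrow> kernel_bound {..<dim_row A} {..<dim_col A} (\<lambda>i j. A $$ (i, j)) C"
  by (simp add: opnorm_le_iff vnorm_bound_iff_kernel_bound)

lemma opnorm_kernel_bound:
  "A \<in> carrier_mat m n \<Longrightarrow> kernel_bound {..<m} {..<n} (\<lambda>i j. A $$ (i, j)) (opnorm A)"
  using opnorm_le_iff_kernel_bound[of "opnorm A" A] by auto

lemma kernel_bound_entry:
  assumes "kernel_bound I J K C" "finite I" "finite J" "i \<in> I" "j \<in> J"
  shows "cmod (K i j) \<le> C"
proof -
  let ?f = "\<lambda>k. if k = j then 1 else 0 :: complex"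
  have s: "(\<Sum>k\<in>J. K i k * ?f k) = K i j" for i
    using assms by (simp add: if_distrib sum.delta' cong: if_cong)
  have "(cl2 J ?f)\<^sup>2 = (\<Sum>k\<in>J. if k = j then 1 else 0)"
    unfolding cl2_square by (auto intro: sum.cong)
  then have "(cl2 J ?f)\<^sup>2 = 1\<^sup>2"
    using assms by simp
  then have "cl2 J ?f = 1"
    by (rule power2_eq_imp_eq) auto
  then have "cl2 I (\<lambda>i. K i j) \<le> C"
    using kernel_boundD[OF assms(1), of ?f] by (simp only: s)
  then show ?thesis
    using cl2_ge_entry[of I i "\<lambda>i. K i j"] assms by simp
qed

lemma entry_le_opnorm: "A \<in> carrier_mat m n \<Longrightarrow> i < m \<Longrightarrow> j < n \<Longrightarrow> cmod (A $$ (i, j)) \<le> opnorm A"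
  using kernel_bound_entry[OF opnorm_kernel_bound, of A m n i j] by simp

lemma opnorm_zero [simp]: "opnorm (0\<^sub>m m n) = 0"
proof -
  have "kernel_bound {..<m} {..<n} (\<lambda>i j. 0 :: complex) 0"
    by (simp add: kernel_bound_def cl2_def L2_set_0')
  then have "kernel_bound {..<m} {..<n} (\<lambda>i j. 0\<^sub>m m n $$ (i, j) :: complex) 0"
    by (subst kernel_bound_cong[where K' = "\<lambda>i j. 0"]) auto
  then have "opnorm (0\<^sub>m m n) \<le> 0"
    by (subst opnorm_le_iff_kernel_bound) auto
  then show ?thesis
    using opnorm_nonneg[of "0\<^sub>m m n"] by linarith
qed

lemma opnorm_add:
  assumes "A \<in> carrier_mat m n" "B \<in> carrier_mat m n"
  shows "opnorm (A + B) \<le> opnorm A + opnorm B"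
proof -
  have "kernel_bound {..<m} {..<n} (\<lambda>i j. A $$ (i, j) + B $$ (i, j)) (opnorm A + opnorm B)"
    by (intro kernel_bound_add opnorm_kernel_bound assms)
  then have "kernel_bound {..<m} {..<n} (\<lambda>i j. (A + B) $$ (i, j)) (opnorm A + opnorm B)"
    by (subst kernel_bound_cong) (use assms in auto)
  then show ?thesis
    using opnorm_le_iff_kernel_bound[of "opnorm A + opnorm B" "A + B"] assms by simp
qed

lemma opnorm_uminus: "opnorm (- A) = opnorm A"
proof -
  have "opnorm (- A) \<le> opnorm A" for A
  proof -
    have "kernel_bound {..<dim_row A} {..<dim_col A} (\<lambda>i j. (-1) * A $$ (i, j)) (cmod (-1) * opnorm A)"
      by (intro kernel_bound_scale opnorm_kernel_bound) auto
    then have "kernel_bound {..<dim_row A} {..<dim_col A} (\<lambda>i j. (- A) $$ (i, j)) (opnorm A)"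
      by (subst kernel_bound_cong[where K' = "\<lambda>i j. (-1) * A $$ (i, j)"]) auto
    then show ?thesis
      using opnorm_le_iff_kernel_bound[of "opnorm A" "- A"] by simp
  qed
  from this[of A] this[of "- A"] show ?thesis
    by simp
qed

lemma opnorm_mult:
  assumes A: "A \<in> carrier_mat m n" and B: "B \<in> carrier_mat n k"
  shows "opnorm (A * B) \<le> opnorm A * opnorm B"
proof -
  have "vnorm (A * B *\<^sub>v v) \<le> opnorm A * opnorm B * vnorm v" if "v \<in> carrier_vec k" for v
  proof -
    have "A * B *\<^sub>v v = A *\<^sub>v (B *\<^sub>v v)"
      using A B that by (rule assoc_mult_mat_vec)
    also have "vnorm \<dots> \<le> opnorm A * vnorm (B *\<^sub>v v)"
      using A B that by (intro vnorm_le_opnorm) auto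
    also have "\<dots> \<le> opnorm A * (opnorm B * vnorm v)"
      using B that by (intro mult_left_mono vnorm_le_opnorm) auto
    finally show ?thesis by simp
  qed
  then show ?thesis
    using A B by (subst opnorm_le_iff) auto
qed

section \<open>Evaluation of free polynomials\<close>

lemma Md_iff:
  "M \<in> Md d \<longleftrightarrow> 1 \<le> fst M \<and> length (snd M) = d \<and> (\<forall>i<d. snd M ! i \<in> carrier_mat (fst M) (fst M))"
  by (auto simp: Md_def all_set_conv_all_nth split: prod.splits)

lemma word_eval_Nil [simp]: "word_eval M [] = 1\<^sub>m (fst M)"
  by (simp add: word_eval_def)

lemma word_eval_Cons [simp]: "word_eval M (i # w) = snd M ! i * word_eval M w"
  by (simp add: word_eval_def)

lemma word_eval_carrier:
  "M \<in> Md d \<Longrightarrow> set w \<subseteq> {..<d} \<Longrightarrow> word_eval M w \<in> carrier_mat (fst M) (fst M)"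
  by (induction w) (auto simp: Md_iff)

lemma word_eval_append:
  assumes "M \<in> Md d" "set u \<subseteq> {..<d}" "set v \<subseteq> {..<d}"
  shows "word_eval M (u @ v) = word_eval M u * word_eval M v"
  using assms(2)
proof (induction u)
  case Nil
  then show ?case using word_eval_carrier[OF assms(1,3)] by simp
next
  case (Cons i u)
  have c: "snd M ! i \<in> carrier_mat (fst M) (fst M)" "word_eval M u \<in> carrier_mat (fst M) (fst M)"
    using Cons.prems assms(1) word_eval_carrier[OF assms(1), of u] by (auto simp: Md_iff)
  show ?case
    using Cons assoc_mult_mat[OF c word_eval_carrier[OF assms(1,3)]] by simp
qed

lemma poly_eval_carrier [simp]: "poly_eval p M \<in> carrier_mat (fst M) (fst M)"
  by (simp add: poly_eval_def)

lemma poly_eval_dim [simp]: "dim_row (poly_eval p M) = fst M" "dim_col (poly_eval p M) = fst M"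
  by (simp_all add: poly_eval_def)

text \<open>Cancellation can shrink the support of a combination, so sums over supports are hard to
  compare directly. Any finite superset T may serve as a common index set.\<close>

lemma poly_eval_index:
  assumes "finite T" "{w. p w \<noteq> 0} \<subseteq> T" "i < fst M" "j < fst M"
  shows "poly_eval p M $$ (i, j) = (\<Sum>w\<in>T. p w * word_eval M w $$ (i, j))"
  unfolding poly_eval_def using assms
  by (simp, intro sum.mono_neutral_left) auto

lemma free_poly_finite: "free_poly d p \<Longrightarrow> finite {w. p w \<noteq> 0}"
  by (simp add: free_poly_def)

lemma free_poly_words: "free_poly d p \<Longrightarrow> p w \<noteq> 0 \<Longrightarrow> set w \<subseteq> {..<d}"
  by (simp add: free_poly_def)

lemma lincomb_support:
  fixes p :: "nat \<Rightarrow> fpoly"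
  shows "{w. (\<Sum>k<K. c k * p k w) \<noteq> 0} \<subseteq> (\<Union>k<K. {w. p k w \<noteq> 0})"
proof
  fix w assume "w \<in> {w. (\<Sum>k<K. c k * p k w) \<noteq> 0}"
  then have "(\<Sum>k<K. c k * p k w) \<noteq> 0" by simp
  then obtain k where "k \<in> {..<K}" "c k * p k w \<noteq> 0"
    by (rule sum.not_neutral_contains_not_neutral)
  then show "w \<in> (\<Union>k<K. {w. p k w \<noteq> 0})" by auto
qed

lemma free_poly_lincomb:
  fixes K :: nat
  assumes "\<And>k. k < K \<Longrightarrow> free_poly d (p k)"
  shows "free_poly d (\<lambda>w. \<Sum>k<K. c k * p k w)"
proof -
  have "finite (\<Union>k<K. {w. p k w \<noteq> 0})"
    using assms by (intro finite_UN_I finite_lessThan free_poly_finite) auto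
  then have "finite {w. (\<Sum>k<K. c k * p k w) \<noteq> 0}"
    using lincomb_support by (rule finite_subset[rotated])
  moreover have "set w \<subseteq> {..<d}" if w: "(\<Sum>k<K. c k * p k w) \<noteq> 0" for w
  proof -
    obtain k where "k < K" "p k w \<noteq> 0"
      using w lincomb_support[of c p K] by blast
    then show ?thesis
      using free_poly_words[OF assms] by simp
  qed
  ultimately show ?thesis
    by (simp add: free_poly_def)
qed

lemma poly_eval_lincomb:
  fixes K :: nat
  assumes "\<And>k. k < K \<Longrightarrow> free_poly d (p k)" "i < fst M" "j < fst M"
  shows "poly_eval (\<lambda>w. \<Sum>k<K. c k * p k w) M $$ (i, j) = (\<Sum>k<K. c k * poly_eval (p k) M $$ (i, j))"
proof -
  let ?T = "\<Union>k<K. {w. p k w \<noteq> 0}"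
  have T: "finite ?T"
    using assms(1) by (intro finite_UN_I finite_lessThan free_poly_finite) auto
  have "poly_eval (\<lambda>w. \<Sum>k<K. c k * p k w) M $$ (i, j)
      = (\<Sum>w\<in>?T. (\<Sum>k<K. c k * p k w) * word_eval M w $$ (i, j))"
    by (rule poly_eval_index[OF T lincomb_support assms(2,3)])
  also have "\<dots> = (\<Sum>k<K. \<Sum>w\<in>?T. c k * (p k w * word_eval M w $$ (i, j)))"
    by (subst sum.swap) (simp add: sum_distrib_right mult.assoc)
  also have "\<dots> = (\<Sum>k<K. c k * poly_eval (p k) M $$ (i, j))"
  proof (rule sum.cong[OF refl])
    fix k assume "k \<in> {..<K}"
    then have "poly_eval (p k) M $$ (i, j) = (\<Sum>w\<in>?T. p k w * word_eval M w $$ (i, j))"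
      using T assms(2,3) by (intro poly_eval_index) auto
    then show "(\<Sum>w\<in>?T. c k * (p k w * word_eval M w $$ (i, j))) = c k * poly_eval (p k) M $$ (i, j)"
      by (simp add: sum_distrib_left)
  qed
  finally show ?thesis .
qed

lemma free_poly_scale: "free_poly d p \<Longrightarrow> free_poly d (\<lambda>w. c * p w)"
  using free_poly_lincomb[of 1 d "\<lambda>_. p" "\<lambda>_. c"] by simp

lemma poly_eval_scale: "free_poly d p \<Longrightarrow> poly_eval (\<lambda>w. c * p w) M = c \<cdot>\<^sub>m poly_eval p M"
  using poly_eval_lincomb[of 1 d "\<lambda>_. p" _ M _ "\<lambda>_. c"] by (intro eq_matI) auto

lemma free_poly_diff: "free_poly d p \<Longrightarrow> free_poly d q \<Longrightarrow> free_poly d (\<lambda>w. p w - q w)"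
  using free_poly_lincomb[of 2 d "\<lambda>k. if k = 0 then p else q" "\<lambda>k. if k = 0 then 1 else -1"]
  by (simp add: numeral_2_eq_2)

lemma poly_eval_diff:
  "free_poly d p \<Longrightarrow> free_poly d q \<Longrightarrow> poly_eval (\<lambda>w. p w - q w) M = poly_eval p M - poly_eval q M"
  using poly_eval_lincomb[of 2 d "\<lambda>k. if k = 0 then p else q" _ M _ "\<lambda>k. if k = 0 then 1 else -1"]
  by (intro eq_matI) (auto simp: numeral_2_eq_2)

section \<open>Words and products in the free algebra\<close>

definition word_poly :: "nat list \<Rightarrow> fpoly" where
  "word_poly u = (\<lambda>w. if w = u then 1 else 0)"

lemma free_poly_word: "set u \<subseteq> {..<d} \<Longrightarrow> free_poly d (word_poly u)"
  by (auto simp: free_poly_def word_poly_def)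

lemma poly_eval_word:
  assumes "M \<in> Md d" "set u \<subseteq> {..<d}"
  shows "poly_eval (word_poly u) M = word_eval M u"
  using word_eval_carrier[OF assms]
  by (intro eq_matI) (auto simp: poly_eval_def word_poly_def)

lemma free_poly_zero: "free_poly d (\<lambda>w. 0)"
  by (simp add: free_poly_def)

lemma poly_eval_zero [simp]: "poly_eval (\<lambda>w. 0) M = 0\<^sub>m (fst M) (fst M)"
  by (intro eq_matI) (auto simp: poly_eval_def)

text \<open>Convolution over the free monoid. Summing over pairs of support words, instead of over
  the factorisations of w, lets \<open>sum.swap\<close> collapse the double sum in
  \<open>poly_eval_mult\<close>.\<close>

definition poly_mult :: "fpoly \<Rightarrow> fpoly \<Rightarrow> fpoly" where
  "poly_mult p q = (\<lambda>w. \<Sum>(u, v)\<in>{u. p u \<noteq> 0} \<times> {v. q v \<noteq> 0}. if w = u @ v then p u * q v else 0)"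

lemma poly_mult_support:
  "{w. poly_mult p q w \<noteq> 0} \<subseteq> (\<lambda>(u, v). u @ v) ` ({u. p u \<noteq> 0} \<times> {v. q v \<noteq> 0})"
proof
  fix w assume "w \<in> {w. poly_mult p q w \<noteq> 0}"
  then have "(\<Sum>(u, v)\<in>{u. p u \<noteq> 0} \<times> {v. q v \<noteq> 0}. if w = u @ v then p u * q v else 0) \<noteq> 0"
    by (simp add: poly_mult_def)
  then obtain uv where "uv \<in> {u. p u \<noteq> 0} \<times> {v. q v \<noteq> 0}"
    "(case uv of (u, v) \<Rightarrow> if w = u @ v then p u * q v else 0) \<noteq> 0"
    by (rule sum.not_neutral_contains_not_neutral)
  then show "w \<in> (\<lambda>(u, v). u @ v) ` ({u. p u \<noteq> 0} \<times> {v. q v \<noteq> 0})"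
    by (force split: prod.splits if_splits)
qed

lemma free_poly_mult:
  assumes "free_poly d p" "free_poly d q"
  shows "free_poly d (poly_mult p q)"
proof -
  have "finite {w. poly_mult p q w \<noteq> 0}"
    using poly_mult_support by (rule finite_subset) (use assms in \<open>auto simp: free_poly_def\<close>)
  moreover have "set w \<subseteq> {..<d}" if "poly_mult p q w \<noteq> 0" for w
    using poly_mult_support[of p q] that free_poly_words[OF assms(1)] free_poly_words[OF assms(2)]
    by fastforce
  ultimately show ?thesis
    by (simp add: free_poly_def)
qed

lemma index_mult_mat_sum:
  assumes "A \<in> carrier_mat m n" "B \<in> carrier_mat n k" "i < m" "j < k"
  shows "(A * B) $$ (i, j) = (\<Sum>l<n. A $$ (i, l) * B $$ (l, j))"
  using assms by (auto simp: scalar_prod_def atLeast0LessThan intro!: sum.cong)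

text \<open>B may be rectangular, as required for intertwiners between points of different
  dimensions.\<close>

lemma poly_eval_mult_left:
  assumes "M \<in> Md d" "free_poly d p" "B \<in> carrier_mat (fst M) k" "i < fst M" "j < k"
  shows "(poly_eval p M * B) $$ (i, j) = (\<Sum>w | p w \<noteq> 0. p w * (word_eval M w * B) $$ (i, j))"
proof -
  have "(poly_eval p M * B) $$ (i, j)
      = (\<Sum>l<fst M. \<Sum>w | p w \<noteq> 0. p w * word_eval M w $$ (i, l) * B $$ (l, j))"
    using assms free_poly_finite[OF assms(2)]
    by (subst index_mult_mat_sum[OF poly_eval_carrier assms(3-5)])
      (auto simp: poly_eval_index[of "{w. p w \<noteq> 0}"] sum_distrib_right)
  also have "\<dots> = (\<Sum>w | p w \<noteq> 0. p w * (\<Sum>l<fst M. word_eval M w $$ (i, l) * B $$ (l, j)))"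
    by (subst sum.swap) (simp add: sum_distrib_left mult.assoc)
  also have "\<dots> = (\<Sum>w | p w \<noteq> 0. p w * (word_eval M w * B) $$ (i, j))"
    using assms
    by (intro sum.cong refl arg_cong2[where f = "(*)"])
      (auto simp: index_mult_mat_sum[OF word_eval_carrier[OF assms(1) free_poly_words[OF assms(2)]] assms(3-5)])
  finally show ?thesis .
qed

lemma poly_eval_mult_right:
  assumes "M \<in> Md d" "free_poly d p" "B \<in> carrier_mat k (fst M)" "i < k" "j < fst M"
  shows "(B * poly_eval p M) $$ (i, j) = (\<Sum>w | p w \<noteq> 0. p w * (B * word_eval M w) $$ (i, j))"
proof -
  have "(B * poly_eval p M) $$ (i, j)
      = (\<Sum>l<fst M. \<Sum>w | p w \<noteq> 0. B $$ (i, l) * (p w * word_eval M w $$ (l, j)))"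
    using assms free_poly_finite[OF assms(2)]
    by (subst index_mult_mat_sum[OF assms(3) poly_eval_carrier assms(4,5)])
      (auto simp: poly_eval_index[of "{w. p w \<noteq> 0}"] sum_distrib_left)
  also have "\<dots> = (\<Sum>w | p w \<noteq> 0. p w * (\<Sum>l<fst M. B $$ (i, l) * word_eval M w $$ (l, j)))"
    by (subst sum.swap) (simp add: sum_distrib_left mult_ac)
  also have "\<dots> = (\<Sum>w | p w \<noteq> 0. p w * (B * word_eval M w) $$ (i, j))"
    using assms
    by (intro sum.cong refl arg_cong2[where f = "(*)"])
      (auto simp: index_mult_mat_sum[OF assms(3) word_eval_carrier[OF assms(1) free_poly_words[OF assms(2)]] assms(4,5)])
  finally show ?thesis .
qed

lemma poly_eval_mult:
  assumes "M \<in> Md d" "free_poly d p" "free_poly d q"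
  shows "poly_eval (poly_mult p q) M = poly_eval p M * poly_eval q M"
proof (rule eq_matI)
  fix i j assume "i < dim_row (poly_eval p M * poly_eval q M)" "j < dim_col (poly_eval p M * poly_eval q M)"
  then have ij: "i < fst M" "j < fst M" by auto
  let ?P = "{w. p w \<noteq> 0}" and ?Q = "{w. q w \<noteq> 0}"
  let ?T = "(\<lambda>(u, v). u @ v) ` (?P \<times> ?Q)"
  have fin: "finite (?P \<times> ?Q)" using assms by (auto simp: free_poly_def)
  have "poly_eval (poly_mult p q) M $$ (i, j) = (\<Sum>w\<in>?T. poly_mult p q w * word_eval M w $$ (i, j))"
    using fin poly_mult_support ij by (intro poly_eval_index) auto
  also have "\<dots> = (\<Sum>uv\<in>?P \<times> ?Q. \<Sum>w\<in>?T.
      if w = fst uv @ snd uv then p (fst uv) * q (snd uv) * word_eval M w $$ (i, j) else 0)"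
    unfolding poly_mult_def sum_distrib_right
    by (subst sum.swap) (auto intro!: sum.cong)
  \<comment> \<open>For a fixed pair (u, v) only w = u @ v contributes, and this word lies in the
    index set.\<close>
  also have "\<dots> = (\<Sum>uv\<in>?P \<times> ?Q. p (fst uv) * q (snd uv) * word_eval M (fst uv @ snd uv) $$ (i, j))"
    using fin by (intro sum.cong refl) (auto simp: sum.delta)
  also have "\<dots> = (\<Sum>u\<in>?P. \<Sum>v\<in>?Q. p u * q v * (word_eval M u * word_eval M v) $$ (i, j))"
    unfolding sum.cartesian_product
    by (intro sum.cong refl)
      (auto simp: word_eval_append[OF assms(1)] free_poly_words[OF assms(2)] free_poly_words[OF assms(3)])
  also have "\<dots> = (\<Sum>u\<in>?P. p u * (\<Sum>v\<in>?Q. q v * (word_eval M u * word_eval M v) $$ (i, j)))"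
    by (simp add: sum_distrib_left mult.assoc)
  also have "\<dots> = (\<Sum>u\<in>?P. p u * (word_eval M u * poly_eval q M) $$ (i, j))"
    using assms ij
    by (intro sum.cong refl arg_cong2[where f = "(*)"])
      (auto intro!: poly_eval_mult_right[symmetric, OF assms(1,3)] word_eval_carrier[OF assms(1)]
        dest: free_poly_words[OF assms(2)])
  also have "\<dots> = (poly_eval p M * poly_eval q M) $$ (i, j)"
    using ij by (intro poly_eval_mult_left[symmetric, OF assms(1,2)]) auto
  finally show "poly_eval (poly_mult p q) M $$ (i, j) = (poly_eval p M * poly_eval q M) $$ (i, j)" .
qed auto

section \<open>Intertwiners, direct sums and similarities\<close>

lemma word_eval_intertwine:
  assumes x: "x \<in> Md d" and y: "y \<in> Md d" and V: "V \<in> carrier_mat (fst x) (fst y)"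
    and eq: "\<And>i. i < d \<Longrightarrow> snd x ! i * V = V * snd y ! i"
    and "set w \<subseteq> {..<d}"
  shows "word_eval x w * V = V * word_eval y w"
  using assms(5)
proof (induction w)
  case Nil
  then show ?case using V by simp
next
  case (Cons i w)
  have c: "snd x ! i \<in> carrier_mat (fst x) (fst x)" "word_eval x w \<in> carrier_mat (fst x) (fst x)"
    "snd y ! i \<in> carrier_mat (fst y) (fst y)" "word_eval y w \<in> carrier_mat (fst y) (fst y)"
    using Cons.prems x y word_eval_carrier[OF x, of w] word_eval_carrier[OF y, of w] by (auto simp: Md_iff)
  have "word_eval x (i # w) * V = snd x ! i * (word_eval x w * V)"
    using assoc_mult_mat[OF c(1,2) V] by simp
  also have "\<dots> = snd x ! i * V * word_eval y w"
    using Cons assoc_mult_mat[OF c(1) V c(4)] by simp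
  also have "\<dots> = V * (snd y ! i * word_eval y w)"
    using Cons.prems eq assoc_mult_mat[OF V c(3,4)] by simp
  finally show ?case by simp
qed

text \<open>The relation x V = V y passes from letters to words by induction and to polynomials by
  linearity. V may be rectangular and singular: this covers the similarity in
  \<open>poly_eval_conj\<close> as well as the coordinate map in
  \<open>left_regular_point\<close>.\<close>

lemma poly_eval_intertwine:
  assumes x: "x \<in> Md d" and y: "y \<in> Md d" and V: "V \<in> carrier_mat (fst x) (fst y)"
    and eq: "\<And>i. i < d \<Longrightarrow> snd x ! i * V = V * snd y ! i"
    and p: "free_poly d p"
  shows "poly_eval p x * V = V * poly_eval p y"
proof (rule eq_matI)
  fix i j assume "i < dim_row (V * poly_eval p y)" "j < dim_col (V * poly_eval p y)"
  then have ij: "i < fst x" "j < fst y" using V by auto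
  then show "(poly_eval p x * V) $$ (i, j) = (V * poly_eval p y) $$ (i, j)"
    unfolding poly_eval_mult_left[OF x p V ij] poly_eval_mult_right[OF y p V ij]
    by (intro sum.cong refl arg_cong2[where f = "(*)"])
      (auto simp: word_eval_intertwine[OF x y V eq] free_poly_words[OF p])
qed (use V in auto)

lemma dsum_in_Md:
  assumes "x \<in> Md d" "y \<in> Md d" shows "dsum x y \<in> Md d"
  using assms by (auto simp: Md_iff dsum_def)

lemma fst_dsum [simp]: "fst (dsum x y) = fst x + fst y"
  by (simp add: dsum_def)

lemma dsum_mat_carrier:
  "A \<in> carrier_mat m m \<Longrightarrow> B \<in> carrier_mat k k \<Longrightarrow> dsum_mat A B \<in> carrier_mat (m + k) (m + k)"
  by (auto simp: dsum_mat_def)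

lemma word_eval_dsum:
  assumes x: "x \<in> Md d" and y: "y \<in> Md d" and "set w \<subseteq> {..<d}"
  shows "word_eval (dsum x y) w = dsum_mat (word_eval x w) (word_eval y w)"
  using assms(3)
proof (induction w)
  case Nil
  then show ?case by (simp add: dsum_mat_def)
next
  case (Cons i w)
  have c: "snd x ! i \<in> carrier_mat (fst x) (fst x)" "word_eval x w \<in> carrier_mat (fst x) (fst x)"
    "snd y ! i \<in> carrier_mat (fst y) (fst y)" "word_eval y w \<in> carrier_mat (fst y) (fst y)"
    using Cons.prems x y word_eval_carrier[OF x, of w] word_eval_carrier[OF y, of w] by (auto simp: Md_iff)
  have "snd (dsum x y) ! i = dsum_mat (snd x ! i) (snd y ! i)"
    using Cons.prems x y c[THEN carrier_matD(1)] c[THEN carrier_matD(2)]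
    by (simp add: dsum_def dsum_mat_def Md_iff)
  then show ?case
    using Cons c unfolding dsum_mat_def
    by (auto simp: mult_four_block_mat[OF c(1) _ _ c(3) c(2) _ _ c(4)])
qed

lemma poly_eval_dsum:
  assumes x: "x \<in> Md d" and y: "y \<in> Md d" and p: "free_poly d p"
  shows "poly_eval p (dsum x y) = dsum_mat (poly_eval p x) (poly_eval p y)"
proof (rule eq_matI)
  fix i j assume "i < dim_row (dsum_mat (poly_eval p x) (poly_eval p y))"
    "j < dim_col (dsum_mat (poly_eval p x) (poly_eval p y))"
  then have ij: "i < fst x + fst y" "j < fst x + fst y" by (auto simp: dsum_mat_def)
  have "poly_eval p (dsum x y) $$ (i, j)
      = (\<Sum>w | p w \<noteq> 0. p w * dsum_mat (word_eval x w) (word_eval y w) $$ (i, j))"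
    using ij free_poly_finite[OF p]
    by (auto simp: poly_eval_index[of "{w. p w \<noteq> 0}"] word_eval_dsum[OF x y free_poly_words[OF p]])
  also have "\<dots> = dsum_mat (poly_eval p x) (poly_eval p y) $$ (i, j)"
  proof -
    have d: "dim_row (word_eval x w) = fst x" "dim_col (word_eval x w) = fst x"
      "dim_row (word_eval y w) = fst y" "dim_col (word_eval y w) = fst y" if "p w \<noteq> 0" for w
      using word_eval_carrier[OF x free_poly_words[OF p that]]
        word_eval_carrier[OF y free_poly_words[OF p that]] by auto
    consider "i < fst x" "j < fst x" | "i < fst x" "\<not> j < fst x"
      | "\<not> i < fst x" "j < fst x" | "\<not> i < fst x" "\<not> j < fst x" by blast
    then show ?thesis
      using ij free_poly_finite[OF p]
      by cases (auto simp: dsum_mat_def d poly_eval_index[of "{w. p w \<noteq> 0}"] intro!: sum.cong sum.neutral)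
  qed
  finally show "poly_eval p (dsum x y) $$ (i, j) = dsum_mat (poly_eval p x) (poly_eval p y) $$ (i, j)" .
qed (auto simp: dsum_mat_def)

lemma fst_conj_pt [simp]: "fst (conj_pt t s x) = fst x"
  by (simp add: conj_pt_def)

lemma conj_pt_in_Md:
  assumes "x \<in> Md d" "s \<in> carrier_mat (fst x) (fst x)" "t \<in> carrier_mat (fst x) (fst x)"
  shows "conj_pt t s x \<in> Md d"
  using assms by (auto simp: Md_iff conj_pt_def)

text \<open>Because s t = 1, the matrix s intertwines x with its conjugate; multiplying by t on the
  left cancels s.\<close>

lemma poly_eval_conj:
  assumes x: "x \<in> Md d" and s: "s \<in> carrier_mat (fst x) (fst x)" and t: "t \<in> carrier_mat (fst x) (fst x)"
    and st: "s * t = 1\<^sub>m (fst x)" "t * s = 1\<^sub>m (fst x)" and p: "free_poly d p"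
  shows "poly_eval p (conj_pt t s x) = t * poly_eval p x * s"
proof -
  let ?z = "conj_pt t s x"
  have "poly_eval p x * s = s * poly_eval p ?z"
  proof (rule poly_eval_intertwine[OF x conj_pt_in_Md[OF x s t] _ _ p])
    fix i assume "i < d"
    then have X: "snd x ! i \<in> carrier_mat (fst x) (fst x)" and z: "snd ?z ! i = t * snd x ! i * s"
      using x by (auto simp: Md_iff conj_pt_def)
    have "s * (t * snd x ! i * s) = s * (t * snd x ! i) * s"
      by (rule assoc_mult_mat[symmetric, OF s mult_carrier_mat[OF t X] s])
    also have "\<dots> = snd x ! i * s"
      using X by (simp add: assoc_mult_mat[symmetric, OF s t X] st)
    finally show "snd x ! i * s = s * snd ?z ! i"
      by (simp add: z)
  qed (use s in simp)
  moreover have z: "poly_eval p ?z \<in> carrier_mat (fst x) (fst x)"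
    using poly_eval_carrier[of p ?z] by simp
  ultimately have "t * poly_eval p x * s = t * s * poly_eval p ?z"
    by (simp add: assoc_mult_mat[OF t poly_eval_carrier s] assoc_mult_mat[OF t s z])
  then show ?thesis
    using z by (simp add: st)
qed

text \<open>A unipotent similarity keeps the diagonal blocks and writes the intertwining defect of L
  into the corner. Applied to values of \<delta> and of \<phi> alike, it links the defect of one to
  the defect of the other.\<close>

lemma conj_dsum_upper:
  assumes A: "A \<in> carrier_mat m m" and B: "B \<in> carrier_mat k k" and L: "L \<in> carrier_mat m k"
  shows "four_block_mat (1\<^sub>m m) (- L) (0\<^sub>m k m) (1\<^sub>m k) * dsum_mat A B
      * four_block_mat (1\<^sub>m m) L (0\<^sub>m k m) (1\<^sub>m k)
    = four_block_mat A (A * L - L * B) (0\<^sub>m k m) B"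
proof -
  have 1: "four_block_mat (1\<^sub>m m) (- L) (0\<^sub>m k m) (1\<^sub>m k) * dsum_mat A B
      = four_block_mat A (- L * B) (0\<^sub>m k m) B"
    unfolding dsum_mat_def using A B L
    by (subst mult_four_block_mat[where ?nr1.0 = m and ?n1.0 = m and ?n2.0 = k and ?nr2.0 = k and ?nc1.0 = m and ?nc2.0 = k]) auto
  have "four_block_mat A (- L * B) (0\<^sub>m k m) B * four_block_mat (1\<^sub>m m) L (0\<^sub>m k m) (1\<^sub>m k)
    = four_block_mat A (A * L + - L * B) (0\<^sub>m k m) B"
    using A B L
    by (subst mult_four_block_mat[where ?nr1.0 = m and ?n1.0 = m and ?n2.0 = k and ?nr2.0 = k and ?nc1.0 = m and ?nc2.0 = k]) auto
  moreover have "A * L + - L * B = A * L - L * B"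
    using A B L by (intro eq_matI) auto
  ultimately show ?thesis
    using 1 by simp
qed

lemma unipotent_inverse:
  assumes L: "(L :: complex mat) \<in> carrier_mat m k"
  shows "four_block_mat (1\<^sub>m m) L (0\<^sub>m k m) (1\<^sub>m k) * four_block_mat (1\<^sub>m m) (- L) (0\<^sub>m k m) (1\<^sub>m k) = 1\<^sub>m (m + k)"
    and "four_block_mat (1\<^sub>m m) (- L) (0\<^sub>m k m) (1\<^sub>m k) * four_block_mat (1\<^sub>m m) L (0\<^sub>m k m) (1\<^sub>m k) = 1\<^sub>m (m + k)"
proof -
  have z: "L + - L = 0\<^sub>m m k" "- L + L = 0\<^sub>m m k"
    using L by (auto intro!: eq_matI)
  have [simp]: "- 0\<^sub>m k k + 1\<^sub>m k = (1\<^sub>m k :: complex mat)"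
    by (auto intro!: eq_matI)
  show "four_block_mat (1\<^sub>m m) L (0\<^sub>m k m) (1\<^sub>m k) * four_block_mat (1\<^sub>m m) (- L) (0\<^sub>m k m) (1\<^sub>m k) = 1\<^sub>m (m + k)"
    using L z
    by (subst mult_four_block_mat[where ?nr1.0 = m and ?n1.0 = m and ?n2.0 = k and ?nr2.0 = k and ?nc1.0 = m and ?nc2.0 = k]) auto
  show "four_block_mat (1\<^sub>m m) (- L) (0\<^sub>m k m) (1\<^sub>m k) * four_block_mat (1\<^sub>m m) L (0\<^sub>m k m) (1\<^sub>m k) = 1\<^sub>m (m + k)"
    using L z
    by (subst mult_four_block_mat[where ?nr1.0 = m and ?n1.0 = m and ?n2.0 = k and ?nr2.0 = k and ?nc1.0 = m and ?nc2.0 = k]) auto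
qed

section \<open>Basic free open sets\<close>

text \<open>Together with \<open>block_index_inj\<close> this makes the flattening used in
  \<open>pmat_eval\<close> a bijection from pairs (block, position) to indices.\<close>

lemma block_index_image: "(\<lambda>(a, i). a * n + i) ` ({..<r} \<times> {..<n}) = {..<r * n :: nat}"
proof
  show "(\<lambda>(a, i). a * n + i) ` ({..<r} \<times> {..<n}) \<subseteq> {..<r * n}"
  proof clarsimp
    fix a i :: nat assume "a < r" "i < n"
    then have "a * n + i < Suc a * n" by simp
    also have "\<dots> \<le> r * n" using \<open>a < r\<close> by (intro mult_le_mono1) simp
    finally show "a * n + i < r * n" .
  qed
  show "{..<r * n} \<subseteq> (\<lambda>(a, i). a * n + i) ` ({..<r} \<times> {..<n})"
  proof
    fix q assume "q \<in> {..<r * n}"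
    then have "q div n < r" "q mod n < n" "q = q div n * n + q mod n"
      by (cases "n = 0"; simp add: less_mult_imp_div_less)+
    then show "q \<in> (\<lambda>(a, i). a * n + i) ` ({..<r} \<times> {..<n})"
      by (intro image_eqI[where x = "(q div n, q mod n)"]) auto
  qed
qed

lemma block_index_inj: "inj_on (\<lambda>(a, i). a * n + i :: nat) (A \<times> {..<n})"
proof (rule inj_onI, clarify)
  fix a i b j :: nat
  assume eq: "a * n + i = b * n + j" and i: "i < n" and j: "j < n"
  have "(a * n + i) div n = a" "(b * n + j) div n = b" "(a * n + i) mod n = i" "(b * n + j) mod n = j"
    using i j by simp_all
  then show "a = b \<and> i = j" using eq by simp
qed

lemma lessThan_add_image: "{..<m + k} = {..<m} \<union> (\<lambda>i. m + i) ` {..<k :: nat}"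
proof
  show "{..<m + k} \<subseteq> {..<m} \<union> (\<lambda>i. m + i) ` {..<k}"
  proof
    fix i assume "i \<in> {..<m + k}"
    then show "i \<in> {..<m} \<union> (\<lambda>i. m + i) ` {..<k}"
      by (cases "i < m") (auto intro!: image_eqI[where x = "i - m"])
  qed
qed auto

lemma Times_lessThan_add:
  "A \<times> {..<m + k} = A \<times> {..<m} \<union> (\<lambda>(a, i). (a, m + i)) ` (A \<times> {..<k :: nat})"
  unfolding lessThan_add_image by auto

lemma lessThan_add_Times:
  "{..<m + k} \<times> B = {..<m} \<times> B \<union> (\<lambda>(a, i). (m + a, i)) ` ({..<k :: nat} \<times> B)"
  unfolding lessThan_add_image by auto

section \<open>Norms of matrices of polynomials at block triangular points\<close>

lemma pmat_eval_dim [simp]: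
  "dim_row (pmat_eval r s \<delta> M) = r * fst M" "dim_col (pmat_eval r s \<delta> M) = s * fst M"
  by (simp_all add: pmat_eval_def Let_def)

text \<open>The bridge from the flattened matrix to pairs of indices; the block decompositions below
  are carried out on the right-hand side.\<close>

lemma opnorm_pmat_eval_le_iff:
  assumes "0 \<le> C"
  shows "opnorm (pmat_eval r s \<delta> M) \<le> C \<longleftrightarrow>
    kernel_bound ({..<r} \<times> {..<fst M}) ({..<s} \<times> {..<fst M})
      (\<lambda>(a, i) (b, j). poly_eval (\<delta> a b) M $$ (i, j)) C"
proof -
  let ?n = "fst M" and ?h = "\<lambda>(a, i). a * fst M + i"
  have "opnorm (pmat_eval r s \<delta> M) \<le> C \<longleftrightarrow>
      kernel_bound {..<r * ?n} {..<s * ?n} (\<lambda>i j. pmat_eval r s \<delta> M $$ (i, j)) C"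
    using opnorm_le_iff_kernel_bound[OF assms] by simp
  also have "\<dots> \<longleftrightarrow> kernel_bound ({..<r} \<times> {..<?n}) ({..<s} \<times> {..<?n})
      (\<lambda>x y. pmat_eval r s \<delta> M $$ (?h x, ?h y)) C"
    unfolding block_index_image[symmetric] by (rule kernel_bound_reindex) (rule block_index_inj)+
  also have "\<dots> \<longleftrightarrow> kernel_bound ({..<r} \<times> {..<fst M}) ({..<s} \<times> {..<fst M})
      (\<lambda>(a, i) (b, j). poly_eval (\<delta> a b) M $$ (i, j)) C"
  proof (rule kernel_bound_cong)
    fix p q assume pq: "p \<in> {..<r} \<times> {..<?n}" "q \<in> {..<s} \<times> {..<?n}"
    obtain a i b j where [simp]: "p = (a, i)" "q = (b, j)" by fastforce
    have *: "a \<in> {..<r}" "i \<in> {..<?n}" "b \<in> {..<s}" "j \<in> {..<?n}" using pq by auto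
    then have "a * ?n + i < r * ?n" "b * ?n + j < s * ?n"
      using block_index_image[of ?n r] block_index_image[of ?n s] by auto
    with * show "pmat_eval r s \<delta> M $$ (?h p, ?h q) =
        (case p of (a, i) \<Rightarrow> \<lambda>(b, j). poly_eval (\<delta> a b) M $$ (i, j)) q"
      by (simp add: pmat_eval_def Let_def)
  qed
  finally show ?thesis .
qed

lemma pmat_kernel_bound:
  "kernel_bound ({..<r} \<times> {..<fst M}) ({..<s} \<times> {..<fst M})
      (\<lambda>(a, i) (b, j). poly_eval (\<delta> a b) M $$ (i, j)) (opnorm (pmat_eval r s \<delta> M))"
  by (rule iffD1[OF opnorm_pmat_eval_le_iff]) simp_all

lemma kernel_bound_corner:
  assumes "kernel_bound I2 J2 K C" "0 \<le> C" "finite I1" "finite I2" "finite J1" "finite J2"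
    and "I1 \<inter> I2 = {}" "J1 \<inter> J2 = {}"
    and "\<And>i j. i \<in> I1 \<union> I2 \<Longrightarrow> j \<in> J1 \<Longrightarrow> K i j = 0" "\<And>i j. i \<in> I1 \<Longrightarrow> j \<in> J2 \<Longrightarrow> K i j = 0"
  shows "kernel_bound (I1 \<union> I2) (J1 \<union> J2) K C"
proof (rule kernel_bound_block_diag)
  have "kernel_bound I1 J1 (\<lambda>i j. 0) C"
    using assms(2) by (simp add: kernel_bound_def cl2_def L2_set_0')
  then show "kernel_bound I1 J1 K C"
    by (subst kernel_bound_cong[where K' = "\<lambda>i j. 0"]) (auto simp: assms)
qed (use assms in auto)

text \<open>After grouping all x-positions before all y-positions, the value at z is block upper
  triangular. Its diagonal part has norm at most C by Pythagoras, and the corner adds at most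
  \<eta>.\<close>

lemma opnorm_pmat_block_upper:
  assumes z: "fst z = fst x + fst y"
    and ev: "\<And>a b. a < r \<Longrightarrow> b < s \<Longrightarrow> poly_eval (\<delta> a b) z =
      four_block_mat (poly_eval (\<delta> a b) x) (Z a b) (0\<^sub>m (fst y) (fst x)) (poly_eval (\<delta> a b) y)"
    and Z: "\<And>a b. a < r \<Longrightarrow> b < s \<Longrightarrow> Z a b \<in> carrier_mat (fst x) (fst y)"
    and x: "opnorm (pmat_eval r s \<delta> x) \<le> C" and y: "opnorm (pmat_eval r s \<delta> y) \<le> C"
    and \<eta>: "0 \<le> \<eta>" "kernel_bound ({..<r} \<times> {..<fst x}) ({..<s} \<times> {..<fst y})
      (\<lambda>(a, i) (b, j). Z a b $$ (i, j)) \<eta>"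
  shows "opnorm (pmat_eval r s \<delta> z) \<le> C + \<eta>"
proof -
  let ?m = "fst x" and ?k = "fst y"
  let ?sh = "\<lambda>(a, i). (a :: nat, ?m + i)"
  let ?H1 = "\<lambda>r. {..<r} \<times> {..<?m}" and ?H2 = "\<lambda>r. ?sh ` ({..<r :: nat} \<times> {..<?k})"
  have C: "0 \<le> C" using x opnorm_nonneg order_trans by blast
  have split: "{..<r} \<times> {..<?m + ?k} = ?H1 r \<union> ?H2 r" for r
    by (rule Times_lessThan_add)
  have inj: "inj_on ?sh A" for A by (auto simp: inj_on_def)
  \<comment> \<open>The test compares on which side of \<open>fst x\<close> the row and the column
    lie, so it selects the two diagonal blocks; \<open>?E\<close> is the remaining upper right
    corner.\<close>
  let ?D = "\<lambda>(a, i) (b, j).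
    (if (i < ?m) = (j < ?m) then poly_eval (\<delta> a b) z $$ (i, j) else 0)"
  let ?E = "\<lambda>(a, i) (b, j).
    (if i < ?m \<and> \<not> j < ?m then Z a b $$ (i, j - ?m) else 0)"
  have D: "kernel_bound ({..<r} \<times> {..<fst z}) ({..<s} \<times> {..<fst z}) ?D C"
    unfolding z split
  proof (rule kernel_bound_block_diag)
    show "kernel_bound (?H1 r) (?H1 s) ?D C"
      using x unfolding opnorm_pmat_eval_le_iff[OF C]
      by (rule kernel_bound_cong[THEN iffD2, rotated])
        (auto simp: ev poly_eval_dim[of _ x] less_imp_add_positive trans_less_add1)
    show "kernel_bound (?H2 r) (?H2 s) ?D C"
      unfolding kernel_bound_reindex[OF inj inj]
      using y unfolding opnorm_pmat_eval_le_iff[OF C]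
      by (rule kernel_bound_cong[THEN iffD2, rotated]) (auto simp: ev)
  qed (use C in auto)
  \<comment> \<open>Exchanging the two sets of rows puts the corner into the diagonal position that
    \<open>kernel_bound_corner\<close> expects.\<close>
  have E: "kernel_bound ({..<r} \<times> {..<fst z}) ({..<s} \<times> {..<fst z}) ?E \<eta>"
    unfolding z split Un_commute[of "?H1 r"]
  proof (rule kernel_bound_corner)
    have "kernel_bound ((\<lambda>p. p) ` ?H1 r) (?H2 s) ?E \<eta>"
      by (subst kernel_bound_reindex[OF _ inj])
        (use \<eta>(2) in \<open>auto elim!: kernel_bound_cong[THEN iffD1, rotated]\<close>)
    then show "kernel_bound (?H1 r) (?H2 s) ?E \<eta>" by simp
  qed (use \<eta> in auto)
  have "kernel_bound ({..<r} \<times> {..<fst z}) ({..<s} \<times> {..<fst z}) (\<lambda>p q. ?D p q + ?E p q) (C + \<eta>)"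
    by (rule kernel_bound_add[OF D E])
  then have "kernel_bound ({..<r} \<times> {..<fst z}) ({..<s} \<times> {..<fst z})
      (\<lambda>(a, i) (b, j). poly_eval (\<delta> a b) z $$ (i, j)) (C + \<eta>)"
    by (rule kernel_bound_cong[THEN iffD1, rotated]) (auto simp: ev z)
  then show ?thesis
    using opnorm_pmat_eval_le_iff[of "C + \<eta>"] C \<eta>(1) by simp
qed

lemma opnorm_pmat_dsum_le:
  assumes x: "x \<in> Md d" and y: "y \<in> Md d" and \<delta>: "free_pmat d r s \<delta>"
    and "opnorm (pmat_eval r s \<delta> x) \<le> C" "opnorm (pmat_eval r s \<delta> y) \<le> C"
  shows "opnorm (pmat_eval r s \<delta> (dsum x y)) \<le> C"
proof -
  have "opnorm (pmat_eval r s \<delta> (dsum x y)) \<le> C + 0"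
  proof (rule opnorm_pmat_block_upper[where Z = "\<lambda>a b. 0\<^sub>m (fst x) (fst y)"])
    show "kernel_bound ({..<r} \<times> {..<fst x}) ({..<s} \<times> {..<fst y})
      (\<lambda>(a, i) (b, j). 0\<^sub>m (fst x) (fst y) $$ (i, j)) 0"
      by (subst kernel_bound_cong[where K' = "\<lambda>i j. 0"])
        (auto simp: kernel_bound_def cl2_def L2_set_0')
  qed (use assms in \<open>auto simp: poly_eval_dsum[OF x y] free_pmat_def dsum_mat_def\<close>)
  then show ?thesis by simp
qed

text \<open>The values at x and at y are compressions of the value at the direct sum.\<close>

lemma opnorm_pmat_le_dsum:
  assumes x: "x \<in> Md d" and y: "y \<in> Md d" and \<delta>: "free_pmat d r s \<delta>"
  shows "opnorm (pmat_eval r s \<delta> x) \<le> opnorm (pmat_eval r s \<delta> (dsum x y))"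
    and "opnorm (pmat_eval r s \<delta> y) \<le> opnorm (pmat_eval r s \<delta> (dsum x y))"
proof -
  let ?C = "opnorm (pmat_eval r s \<delta> (dsum x y))" and ?m = "fst x" and ?k = "fst y"
  let ?sh = "\<lambda>(a, i). (a :: nat, ?m + i)"
  let ?K = "\<lambda>(a, i) (b, j). poly_eval (\<delta> a b) (dsum x y) $$ (i, j)"
  have K: "kernel_bound ({..<r} \<times> {..<?m + ?k}) ({..<s} \<times> {..<?m + ?k}) ?K ?C"
    using pmat_kernel_bound[of r "dsum x y" s \<delta>] unfolding fst_dsum .
  have ev: "poly_eval (\<delta> a b) (dsum x y) = dsum_mat (poly_eval (\<delta> a b) x) (poly_eval (\<delta> a b) y)"
    if "a < r" "b < s" for a b
    using \<delta> that by (intro poly_eval_dsum[OF x y]) (auto simp: free_pmat_def)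
  have "kernel_bound ({..<r} \<times> {..<?m}) ({..<s} \<times> {..<?m}) ?K ?C"
    by (rule kernel_bound_subset[OF K]) auto
  then have "kernel_bound ({..<r} \<times> {..<?m}) ({..<s} \<times> {..<?m})
      (\<lambda>(a, i) (b, j). poly_eval (\<delta> a b) x $$ (i, j)) ?C"
    by (rule kernel_bound_cong[THEN iffD1, rotated]) (auto simp: ev dsum_mat_def)
  then show "opnorm (pmat_eval r s \<delta> x) \<le> ?C"
    by (simp add: opnorm_pmat_eval_le_iff)
  have "kernel_bound (?sh ` ({..<r} \<times> {..<?k})) (?sh ` ({..<s} \<times> {..<?k})) ?K ?C"
    by (rule kernel_bound_subset[OF K]) auto
  moreover have inj: "inj_on ?sh A" for A by (auto simp: inj_on_def)
  ultimately have "kernel_bound ({..<r} \<times> {..<?k}) ({..<s} \<times> {..<?k}) (\<lambda>p q. ?K (?sh p) (?sh q)) ?C"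
    by (simp only: kernel_bound_reindex[OF inj inj])
  then have "kernel_bound ({..<r} \<times> {..<?k}) ({..<s} \<times> {..<?k})
      (\<lambda>(a, i) (b, j). poly_eval (\<delta> a b) y $$ (i, j)) ?C"
    by (rule kernel_bound_cong[THEN iffD1, rotated]) (auto simp: ev dsum_mat_def)
  then show "opnorm (pmat_eval r s \<delta> y) \<le> ?C"
    by (simp add: opnorm_pmat_eval_le_iff)
qed

section \<open>Closure properties of basic free open sets\<close>

lemma dsum_in_G_iff:
  assumes "x \<in> Md d" "y \<in> Md d" "free_pmat d r s \<delta>"
  shows "dsum x y \<in> G d r s \<delta> \<longleftrightarrow> x \<in> G d r s \<delta> \<and> y \<in> G d r s \<delta>"
proof
  assume "dsum x y \<in> G d r s \<delta>"
  then show "x \<in> G d r s \<delta> \<and> y \<in> G d r s \<delta>"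
    using opnorm_pmat_le_dsum[OF assms] assms by (auto simp: G_def)
next
  assume "x \<in> G d r s \<delta> \<and> y \<in> G d r s \<delta>"
  then show "dsum x y \<in> G d r s \<delta>"
    using opnorm_pmat_dsum_le[OF assms, of "max (opnorm (pmat_eval r s \<delta> x)) (opnorm (pmat_eval r s \<delta> y))"]
      dsum_in_Md[OF assms(1,2)] by (auto simp: G_def)
qed

text \<open>The intersection is defined by the block diagonal matrix of \<delta>1 and \<delta>2,
  whose norm is the maximum of the two norms.\<close>

lemma basic_free_open_Int:
  assumes "is_basic_free_open d U" "is_basic_free_open d V"
  shows "is_basic_free_open d (U \<inter> V)"
proof -
  obtain r1 s1 \<delta>1 r2 s2 \<delta>2 where 1: "free_pmat d r1 s1 \<delta>1" "U = G d r1 s1 \<delta>1"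
    and 2: "free_pmat d r2 s2 \<delta>2" "V = G d r2 s2 \<delta>2"
    using assms unfolding is_basic_free_open_def by blast
  define \<gamma> :: "nat \<Rightarrow> nat \<Rightarrow> fpoly" where "\<gamma> = (\<lambda>a b. if a < r1 \<and> b < s1 then \<delta>1 a b
    else if \<not> a < r1 \<and> \<not> b < s1 then \<delta>2 (a - r1) (b - s1) else (\<lambda>w. 0))"
  have \<gamma>: "free_pmat d (r1 + r2) (s1 + s2) \<gamma>"
    using 1(1) 2(1) by (auto simp: free_pmat_def \<gamma>_def free_poly_zero)
  \<comment> \<open>Knowing which C >= 0 are upper bounds determines the norm, so the maximum
    formula follows without touching the supremum in \<open>opnorm\<close>.\<close>
  have iff: "opnorm (pmat_eval (r1 + r2) (s1 + s2) \<gamma> x) \<le> C \<longleftrightarrow>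
    opnorm (pmat_eval r1 s1 \<delta>1 x) \<le> C \<and> opnorm (pmat_eval r2 s2 \<delta>2 x) \<le> C" if C: "0 \<le> C" for x C
  proof -
    let ?n = "fst x"
    let ?K = "\<lambda>(a, i) (b, j). poly_eval (\<gamma> a b) x $$ (i, j)"
    let ?sh = "\<lambda>t (a, i :: nat). (t + a :: nat, i)"
    have inj: "inj_on (?sh t) A" for t A by (auto simp: inj_on_def)
    have split: "{..<a + b} \<times> {..<?n} = {..<a} \<times> {..<?n} \<union> ?sh a ` ({..<b} \<times> {..<?n})" for a b
      by (rule lessThan_add_Times)
    have A: "kernel_bound ({..<r1} \<times> {..<?n}) ({..<s1} \<times> {..<?n}) ?K C
        \<longleftrightarrow> opnorm (pmat_eval r1 s1 \<delta>1 x) \<le> C"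
      unfolding opnorm_pmat_eval_le_iff[OF C] by (rule kernel_bound_cong) (auto simp: \<gamma>_def)
    have B: "kernel_bound (?sh r1 ` ({..<r2} \<times> {..<?n})) (?sh s1 ` ({..<s2} \<times> {..<?n})) ?K C
        \<longleftrightarrow> opnorm (pmat_eval r2 s2 \<delta>2 x) \<le> C"
      unfolding opnorm_pmat_eval_le_iff[OF C] kernel_bound_reindex[OF inj inj]
      by (rule kernel_bound_cong) (auto simp: \<gamma>_def)
    show ?thesis
    proof
      assume "opnorm (pmat_eval (r1 + r2) (s1 + s2) \<gamma> x) \<le> C"
      then have "kernel_bound ({..<r1 + r2} \<times> {..<?n}) ({..<s1 + s2} \<times> {..<?n}) ?K C"
        by (simp add: opnorm_pmat_eval_le_iff[OF C])
      then have "kernel_bound ({..<r1} \<times> {..<?n}) ({..<s1} \<times> {..<?n}) ?K C"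
        "kernel_bound (?sh r1 ` ({..<r2} \<times> {..<?n})) (?sh s1 ` ({..<s2} \<times> {..<?n})) ?K C"
        by (rule kernel_bound_subset; force)+
      then show "opnorm (pmat_eval r1 s1 \<delta>1 x) \<le> C \<and> opnorm (pmat_eval r2 s2 \<delta>2 x) \<le> C"
        using A B by blast
    next
      assume "opnorm (pmat_eval r1 s1 \<delta>1 x) \<le> C \<and> opnorm (pmat_eval r2 s2 \<delta>2 x) \<le> C"
      then have "kernel_bound ({..<r1 + r2} \<times> {..<?n}) ({..<s1 + s2} \<times> {..<?n}) ?K C"
        unfolding split using A B C by (intro kernel_bound_block_diag) (auto simp: \<gamma>_def)
      then show "opnorm (pmat_eval (r1 + r2) (s1 + s2) \<gamma> x) \<le> C"
        by (simp add: opnorm_pmat_eval_le_iff[OF C])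
    qed
  qed
  have "opnorm (pmat_eval (r1 + r2) (s1 + s2) \<gamma> x)
      = max (opnorm (pmat_eval r1 s1 \<delta>1 x)) (opnorm (pmat_eval r2 s2 \<delta>2 x))" for x
  proof (rule antisym)
    show "opnorm (pmat_eval (r1 + r2) (s1 + s2) \<gamma> x)
      \<le> max (opnorm (pmat_eval r1 s1 \<delta>1 x)) (opnorm (pmat_eval r2 s2 \<delta>2 x))"
      by (subst iff) (auto simp: le_max_iff_disj)
    show "max (opnorm (pmat_eval r1 s1 \<delta>1 x)) (opnorm (pmat_eval r2 s2 \<delta>2 x))
      \<le> opnorm (pmat_eval (r1 + r2) (s1 + s2) \<gamma> x)"
      using iff[of "opnorm (pmat_eval (r1 + r2) (s1 + s2) \<gamma> x)" x] by simp
  qed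
  then have "U \<inter> V = G d (r1 + r2) (s1 + s2) \<gamma>"
    unfolding 1 2 G_def by auto
  then show ?thesis
    using \<gamma> unfolding is_basic_free_open_def by blast
qed

lemma opnorm_smult: "opnorm (c \<cdot>\<^sub>m A) = cmod c * opnorm A"
proof -
  have le: "opnorm (c \<cdot>\<^sub>m A) \<le> cmod c * opnorm A" for c and A :: "complex mat"
  proof -
    have "kernel_bound {..<dim_row A} {..<dim_col A} (\<lambda>i j. c * A $$ (i, j)) (cmod c * opnorm A)"
      by (intro kernel_bound_scale opnorm_kernel_bound) auto
    then have "kernel_bound {..<dim_row A} {..<dim_col A} (\<lambda>i j. (c \<cdot>\<^sub>m A) $$ (i, j)) (cmod c * opnorm A)"
      by (rule kernel_bound_cong[THEN iffD1, rotated]) auto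
    then show ?thesis
      using opnorm_le_iff_kernel_bound[of "cmod c * opnorm A" "c \<cdot>\<^sub>m A"] by simp
  qed
  show ?thesis
  proof (cases "c = 0")
    case True
    then have "c \<cdot>\<^sub>m A = 0\<^sub>m (dim_row A) (dim_col A)" by (intro eq_matI) auto
    then show ?thesis using True by simp
  next
    case False
    have "inverse c \<cdot>\<^sub>m (c \<cdot>\<^sub>m A) = A"
      using False by (intro eq_matI) auto
    then have "opnorm A \<le> cmod (inverse c) * opnorm (c \<cdot>\<^sub>m A)"
      using le[of "inverse c" "c \<cdot>\<^sub>m A"] by simp
    then have "cmod c * opnorm A \<le> opnorm (c \<cdot>\<^sub>m A)"
      using False by (simp add: norm_inverse norm_divide field_simps)
    then show ?thesis using le[of c A] by simp
  qed
qed

text \<open>Dividing \<delta> by t moves the level t to 1. Arbitrary positive levels are what the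
  smallness conditions near a point require.\<close>

lemma basic_free_open_sublevel:
  assumes \<delta>: "free_pmat d r s \<delta>" and t: "0 < t"
  shows "is_basic_free_open d {x \<in> Md d. opnorm (pmat_eval r s \<delta> x) < t}"
proof -
  define c where "c = complex_of_real (1 / t)"
  let ?\<gamma> = "\<lambda>a b w. c * \<delta> a b w"
  have "pmat_eval r s ?\<gamma> x = c \<cdot>\<^sub>m pmat_eval r s \<delta> x" if "x \<in> Md d" for x
  proof (rule eq_matI)
    fix i j assume "i < dim_row (c \<cdot>\<^sub>m pmat_eval r s \<delta> x)" "j < dim_col (c \<cdot>\<^sub>m pmat_eval r s \<delta> x)"
    then have ij: "i < r * fst x" "j < s * fst x" by auto
    then have "free_poly d (\<delta> (i div fst x) (j div fst x))"
      using \<delta> by (auto simp: free_pmat_def less_mult_imp_div_less)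
    moreover have "i mod fst x < fst x" "j mod fst x < fst x"
      using that by (auto simp: Md_iff)
    ultimately show "pmat_eval r s ?\<gamma> x $$ (i, j) = (c \<cdot>\<^sub>m pmat_eval r s \<delta> x) $$ (i, j)"
      using ij by (simp add: pmat_eval_def Let_def poly_eval_scale)
  qed auto
  then have "opnorm (pmat_eval r s ?\<gamma> x) = opnorm (pmat_eval r s \<delta> x) / t" if "x \<in> Md d" for x
    using that t by (simp add: opnorm_smult norm_divide c_def)
  then have "opnorm (pmat_eval r s \<delta> x) < t \<longleftrightarrow> opnorm (pmat_eval r s ?\<gamma> x) < 1" if "x \<in> Md d" for x
    using that t by simp
  then have "{x \<in> Md d. opnorm (pmat_eval r s \<delta> x) < t} = G d r s ?\<gamma>"
    unfolding G_def by blast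
  moreover have "free_pmat d r s ?\<gamma>"
    using \<delta> by (auto simp: free_pmat_def intro!: free_poly_scale)
  ultimately show ?thesis
    unfolding is_basic_free_open_def by blast
qed

lemma basic_free_open_poly:
  assumes p: "free_poly d p" and t: "0 < t"
  shows "is_basic_free_open d {x \<in> Md d. opnorm (poly_eval p x) < t}"
proof -
  have "pmat_eval 1 1 (\<lambda>_ _. p) x = poly_eval p x" for x
    by (intro eq_matI) (auto simp: pmat_eval_def Let_def)
  then show ?thesis
    using basic_free_open_sublevel[of d 1 1 "\<lambda>_ _. p" t] p t by (simp add: free_pmat_def)
qed

text \<open>The zero polynomial imposes no condition. This is the empty intersection, the base case
  for finite families of conditions.\<close>

lemma basic_free_open_Md: "is_basic_free_open d (Md d)"
proof -
  have "Md d = {x \<in> Md d. opnorm (poly_eval (\<lambda>w. 0) x) < 1}" by auto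
  then show ?thesis
    using basic_free_open_poly[OF free_poly_zero, of 1 d] by simp
qed

lemma basic_free_open_polys:
  assumes "finite Q" "\<And>q. q \<in> Q \<Longrightarrow> free_poly d q" "0 < t"
  shows "is_basic_free_open d {x \<in> Md d. \<forall>q\<in>Q. opnorm (poly_eval q x) < t}"
  using assms
proof (induction Q rule: finite_induct)
  case empty
  then show ?case by (simp add: basic_free_open_Md)
next
  case (insert q Q)
  have "{x \<in> Md d. \<forall>q\<in>insert q Q. opnorm (poly_eval q x) < t} =
    {x \<in> Md d. opnorm (poly_eval q x) < t} \<inter> {x \<in> Md d. \<forall>q\<in>Q. opnorm (poly_eval q x) < t}"
    by auto
  then show ?case
    using insert by (simp add: basic_free_open_Int basic_free_open_poly)
qed

lemma basic_free_open_imp_open: "is_basic_free_open d U \<Longrightarrow> free_open d U"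
  unfolding free_open_def by (rule exI[of _ "{U}"]) simp

section \<open>Locally approximable functions are free holomorphic\<close>

lemma free_open_subset_Md: "free_open d D \<Longrightarrow> D \<subseteq> Md d"
  by (auto simp: free_open_def is_basic_free_open_def G_def)

lemma free_open_basic_nhd:
  assumes "free_open d U" "M \<in> U"
  obtains V where "is_basic_free_open d V" "M \<in> V" "V \<subseteq> U"
  using assms unfolding free_open_def by blast

text \<open>In the extended reals an unbounded family has supremum infinity, so the strict
  inequality already contains boundedness.\<close>

lemma SUP_ereal_lessD:
  fixes f :: "'a \<Rightarrow> real"
  assumes "(SUP x\<in>A. ereal (f x)) < ereal e" "x \<in> A"
  shows "f x < e"
proof -
  have "ereal (f x) \<le> (SUP x\<in>A. ereal (f x))"
    using assms(2) by (rule SUP_upper)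
  also have "\<dots> < ereal e" by fact
  finally show ?thesis by simp
qed

lemma eq_if_entries_approx:
  fixes A B :: "complex mat"
  assumes "A \<in> carrier_mat m n" "B \<in> carrier_mat m n"
    and "\<And>i j e. i < m \<Longrightarrow> j < n \<Longrightarrow> 0 < e \<Longrightarrow> cmod (A $$ (i, j) - B $$ (i, j)) \<le> e"
  shows "A = B"
proof (rule eq_matI)
  fix i j assume "i < dim_row B" "j < dim_col B"
  then have ij: "i < m" "j < n" using assms(2) by auto
  have "cmod (A $$ (i, j) - B $$ (i, j)) \<le> 0"
  proof (rule field_le_epsilon)
    fix e :: real assume "0 < e"
    then show "cmod (A $$ (i, j) - B $$ (i, j)) \<le> 0 + e"
      using assms(3)[OF ij] by simp
  qed
  then show "A $$ (i, j) = B $$ (i, j)" by simp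
qed (use assms(1,2) in auto)

lemma locally_approximable_imp_free_holomorphic:
  assumes D: "free_open d D" and gr: "graded_on D \<phi>"
    and approx: "\<forall>M\<in>D. \<forall>\<epsilon>>0. \<exists>U p. free_open d U \<and> M \<in> U \<and> free_poly d p \<and>
       (SUP x\<in>U \<inter> D. ereal (opnorm (\<phi> x - poly_eval p x))) < ereal \<epsilon>"
  shows "free_holomorphic d D \<phi>"
  unfolding free_holomorphic_def
proof
  \<comment> \<open>Shrinking the neighbourhood to a basic one provides a defining matrix, to which
    \<open>dsum_in_G_iff\<close> applies.\<close>
  have basic: "\<exists>V p. is_basic_free_open d V \<and> M \<in> V \<and> free_poly d p \<and>
      (\<forall>x\<in>V \<inter> D. opnorm (\<phi> x - poly_eval p x) < e)" if Me: "M \<in> D" "0 < e" for M e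
  proof -
    obtain U p where U: "free_open d U" "M \<in> U" "free_poly d p"
      "(SUP x\<in>U \<inter> D. ereal (opnorm (\<phi> x - poly_eval p x))) < ereal e"
      using approx[rule_format, OF Me] by (elim exE conjE)
    obtain V where "is_basic_free_open d V" "M \<in> V" "V \<subseteq> U"
      using free_open_basic_nhd[OF U(1,2)] .
    moreover have "\<forall>x\<in>V \<inter> D. opnorm (\<phi> x - poly_eval p x) < e"
      using SUP_ereal_lessD[OF U(4)] \<open>V \<subseteq> U\<close> by blast
    ultimately show ?thesis using U(3) by blast
  qed
  have gr': "\<phi> x \<in> carrier_mat (fst x) (fst x)" if "x \<in> D" for x
    using gr that by (simp add: graded_on_def)
  have pair: "\<exists>p. free_poly d p \<and> (\<forall>w\<in>{x, y, dsum x y}. opnorm (\<phi> w - poly_eval p w) < e)"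
    if xy: "x \<in> D" "y \<in> D" "dsum x y \<in> D" and e: "0 < e" for x y e
  proof -
    obtain r s \<gamma> p where *: "free_pmat d r s \<gamma>" "dsum x y \<in> G d r s \<gamma>" "free_poly d p"
      "\<forall>w\<in>G d r s \<gamma> \<inter> D. opnorm (\<phi> w - poly_eval p w) < e"
      using basic[OF xy(3) e] unfolding is_basic_free_open_def by blast
    have "x \<in> G d r s \<gamma>" "y \<in> G d r s \<gamma>"
      using dsum_in_G_iff[OF _ _ *(1)] *(2) xy free_open_subset_Md[OF D] by blast+
    then show ?thesis using * xy by blast
  qed
  fix M assume M: "M \<in> D"
  obtain V0 where V0: "is_basic_free_open d V0" "M \<in> V0" "V0 \<subseteq> D"
    using free_open_basic_nhd[OF D M] .
  obtain V1 p where V1: "is_basic_free_open d V1" "M \<in> V1" "free_poly d p"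
      "\<And>x. x \<in> V1 \<inter> D \<Longrightarrow> opnorm (\<phi> x - poly_eval p x) < 1"
    using basic[OF M, of 1] by auto
  \<comment> \<open>The + 1 puts M strictly inside the sublevel set of p. Where \<phi> is within 1
    of p, it is then bounded by 1 + N.\<close>
  define N where "N = opnorm (poly_eval p M) + 1"
  have "0 < N" using opnorm_nonneg[of "poly_eval p M"] unfolding N_def by linarith
  then have "is_basic_free_open d (V0 \<inter> V1 \<inter> {x \<in> Md d. opnorm (poly_eval p x) < N})"
    using V0(1) V1(1,3) by (intro basic_free_open_Int basic_free_open_poly)
  then obtain r s \<delta> where \<delta>: "free_pmat d r s \<delta>"
    and G: "V0 \<inter> V1 \<inter> {x \<in> Md d. opnorm (poly_eval p x) < N} = G d r s \<delta>"
    unfolding is_basic_free_open_def by blast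
  let ?G = "G d r s \<delta>"
  have GD: "?G \<subseteq> D" "?G \<subseteq> Md d" using V0 G by auto
  have grG: "\<phi> x \<in> carrier_mat (fst x) (fst x)" if "x \<in> ?G" for x
    using gr' GD that by blast
  have "M \<in> ?G"
    unfolding G[symmetric] using V0 V1 M free_open_subset_Md[OF D] by (auto simp: N_def)
  have "bounded_on ?G \<phi>"
    unfolding bounded_on_def
  proof (intro exI ballI)
    fix x assume x: "x \<in> ?G"
    have "\<phi> x = (\<phi> x - poly_eval p x) + poly_eval p x"
      using grG[OF x] by (intro eq_matI) auto
    moreover have "\<phi> x - poly_eval p x \<in> carrier_mat (fst x) (fst x)"
      using grG[OF x] by auto
    ultimately have "opnorm (\<phi> x) \<le> opnorm (\<phi> x - poly_eval p x) + opnorm (poly_eval p x)"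
      using opnorm_add[OF _ poly_eval_carrier] by metis
    moreover have "x \<in> V1 \<inter> D" "opnorm (poly_eval p x) < N"
      using x GD unfolding G[symmetric] by auto
    ultimately show "opnorm (\<phi> x) \<le> 1 + N"
      using V1(4)[of x] by linarith
  qed
  moreover have "nc_function_on ?G \<phi>"
    unfolding nc_function_on_def
  proof (intro conjI ballI allI impI)
    show "graded_on ?G \<phi>" using gr GD by (auto simp: graded_on_def)
  next
    fix x y assume x: "x \<in> ?G" and y: "y \<in> ?G" and xy: "dsum x y \<in> ?G"
    have c: "\<phi> x \<in> carrier_mat (fst x) (fst x)" "\<phi> y \<in> carrier_mat (fst y) (fst y)"
      using grG x y by blast+
    show "\<phi> (dsum x y) = dsum_mat (\<phi> x) (\<phi> y)"
    proof (rule eq_if_entries_approx)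
      show "\<phi> (dsum x y) \<in> carrier_mat (fst x + fst y) (fst x + fst y)"
        using grG[OF xy] by simp
      then have c': "\<phi> (dsum x y) \<in> carrier_mat (fst x + fst y) (fst x + fst y)" .
      show "dsum_mat (\<phi> x) (\<phi> y) \<in> carrier_mat (fst x + fst y) (fst x + fst y)"
        using c by (rule dsum_mat_carrier)
      fix i j and e :: real
      assume ij: "i < fst x + fst y" "j < fst x + fst y" and e: "0 < e"
      \<comment> \<open>Both sides are compared with the value of one polynomial at the direct sum,
        at a cost of e / 2 each.\<close>
      have De: "x \<in> D" "y \<in> D" "dsum x y \<in> D" "0 < e / 2" using x y xy e GD by auto
      obtain q where q: "free_poly d q" "opnorm (\<phi> x - poly_eval q x) < e / 2"
        "opnorm (\<phi> y - poly_eval q y) < e / 2" "opnorm (\<phi> (dsum x y) - poly_eval q (dsum x y)) < e / 2"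
        using pair[OF De] by blast
      have ev: "poly_eval q (dsum x y) = dsum_mat (poly_eval q x) (poly_eval q y)"
        using x y GD q by (intro poly_eval_dsum) auto
      have xe: "cmod (\<phi> x $$ (a, b) - poly_eval q x $$ (a, b)) \<le> e / 2" if "a < fst x" "b < fst x" for a b
        using entry_le_opnorm[OF minus_carrier_mat[OF poly_eval_carrier], of a x b "\<phi> x" q] that c q(2) by simp
      have ye: "cmod (\<phi> y $$ (a, b) - poly_eval q y $$ (a, b)) \<le> e / 2" if "a < fst y" "b < fst y" for a b
        using entry_le_opnorm[OF minus_carrier_mat[OF poly_eval_carrier], of a y b "\<phi> y" q] that c q(3) by simp
      have 1: "cmod (\<phi> (dsum x y) $$ (i, j) - poly_eval q (dsum x y) $$ (i, j)) \<le> e / 2"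
        using entry_le_opnorm[OF minus_carrier_mat[OF poly_eval_carrier], of i "dsum x y" j "\<phi> (dsum x y)" q]
          ij q(4) c' by simp
      \<comment> \<open>The corners of both block matrices vanish, so the entrywise errors come from
        the diagonal blocks alone.\<close>
      have 2: "cmod (dsum_mat (\<phi> x) (\<phi> y) $$ (i, j) - poly_eval q (dsum x y) $$ (i, j)) \<le> e / 2"
        using ij e c xe[of i j] ye[of "i - fst x" "j - fst x"] unfolding ev dsum_mat_def by auto
      show "cmod (\<phi> (dsum x y) $$ (i, j) - dsum_mat (\<phi> x) (\<phi> y) $$ (i, j)) \<le> e"
        using norm_triangle_ineq4[of "\<phi> (dsum x y) $$ (i, j) - poly_eval q (dsum x y) $$ (i, j)"
            "dsum_mat (\<phi> x) (\<phi> y) $$ (i, j) - poly_eval q (dsum x y) $$ (i, j)"] 1 2 by simp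
    qed
  next
    fix x s t assume x: "x \<in> ?G" and st: "s \<in> carrier_mat (fst x) (fst x) \<and> t \<in> carrier_mat (fst x) (fst x) \<and>
       s * t = 1\<^sub>m (fst x) \<and> t * s = 1\<^sub>m (fst x) \<and> conj_pt t s x \<in> ?G"
    let ?n = "fst x" and ?z = "conj_pt t s x"
    have s: "s \<in> carrier_mat ?n ?n" and t: "t \<in> carrier_mat ?n ?n" and z: "?z \<in> ?G"
      using st by auto
    have c: "\<phi> x \<in> carrier_mat ?n ?n" "\<phi> ?z \<in> carrier_mat ?n ?n"
      using grG[OF x] grG[OF z] by auto
    \<comment> \<open>The direct sum of x and its conjugate provides one polynomial that is close to
      \<phi> at both points.\<close>
    have xz: "dsum x ?z \<in> D"
      using dsum_in_G_iff[OF _ _ \<delta>] x z GD by blast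
    have tc: "t * \<phi> x * s \<in> carrier_mat ?n ?n" using s t c by auto
    \<comment> \<open>K collects two errors: the one at the conjugated point counts once, the one at
      x is multiplied by at most \<open>opnorm t * opnorm s\<close>.\<close>
    define K where "K = 1 + opnorm t * opnorm s"
    have K: "0 < K" unfolding K_def by (intro add_pos_nonneg mult_nonneg_nonneg) auto
    show "\<phi> ?z = t * \<phi> x * s"
    proof (rule eq_if_entries_approx[OF c(2) tc])
      fix i j and e :: real
      assume ij: "i < ?n" "j < ?n" and e: "0 < e"
      obtain q where q: "free_poly d q" "opnorm (\<phi> x - poly_eval q x) < e / K"
        "opnorm (\<phi> ?z - poly_eval q ?z) < e / K"
        using pair[OF _ _ xz, of "e / K"] x z GD e K by auto
      let ?E = "\<phi> x - poly_eval q x" and ?F = "\<phi> ?z - poly_eval q ?z"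
      have ec: "?E \<in> carrier_mat ?n ?n" and fc: "?F \<in> carrier_mat ?n ?n"
        using c poly_eval_carrier[of q ?z] by auto
      have ev: "poly_eval q ?z = t * poly_eval q x * s"
        using poly_eval_conj[OF _ s t _ _ q(1)] x GD st by blast
      have "t * ?E * s = t * \<phi> x * s - poly_eval q ?z"
        unfolding ev using s t c
        by (simp add: mult_minus_distrib_mat[OF t c(1) poly_eval_carrier]
            minus_mult_distrib_mat[OF mult_carrier_mat[OF t c(1)] mult_carrier_mat[OF t poly_eval_carrier] s])
      then have eq: "(\<phi> ?z) $$ (i, j) - (t * \<phi> x * s) $$ (i, j) = ?F $$ (i, j) - (t * ?E * s) $$ (i, j)"
        using ij c s t by simp
      have "opnorm (t * ?E * s) \<le> opnorm (t * ?E) * opnorm s"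
        using ec s t by (intro opnorm_mult) auto
      also have "\<dots> \<le> opnorm t * opnorm ?E * opnorm s"
        by (intro mult_right_mono opnorm_mult[OF t ec]) auto
      also have "\<dots> \<le> opnorm t * (e / K) * opnorm s"
        using q(2) by (intro mult_right_mono mult_left_mono) auto
      finally have 1: "cmod ((t * ?E * s) $$ (i, j)) \<le> opnorm t * (e / K) * opnorm s"
        using entry_le_opnorm[of "t * ?E * s" ?n ?n i j] ij s t ec by (auto simp del: index_mult_mat)
      have 2: "cmod (?F $$ (i, j)) \<le> e / K"
        using entry_le_opnorm[OF fc ij] q(3) by linarith
      have "cmod ((\<phi> ?z) $$ (i, j) - (t * \<phi> x * s) $$ (i, j)) \<le> e / K + opnorm t * (e / K) * opnorm s"
        unfolding eq using norm_triangle_ineq4[of "?F $$ (i, j)" "(t * ?E * s) $$ (i, j)"] 1 2 by linarith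
      also have "\<dots> = (1 + opnorm t * opnorm s) * (e / K)"
        by (simp add: algebra_simps add_divide_distrib)
      also have "\<dots> = e" using K by (simp add: K_def[symmetric])
      finally show "cmod ((\<phi> ?z) $$ (i, j) - (t * \<phi> x * s) $$ (i, j)) \<le> e" .
    qed
  qed
  ultimately show "\<exists>r s \<delta>. free_pmat d r s \<delta> \<and> M \<in> G d r s \<delta> \<and> G d r s \<delta> \<subseteq> D \<and>
      nc_function_on (G d r s \<delta>) \<phi> \<and> bounded_on (G d r s \<delta>) \<phi>"
    using \<delta> \<open>M \<in> ?G\<close> GD by blast
qed

section \<open>The left regular representation of a point\<close>

definition orthonormal_family :: "'i set \<Rightarrow> nat \<Rightarrow> (nat \<Rightarrow> 'i \<Rightarrow> complex) \<Rightarrow> bool" where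
  "orthonormal_family I k e \<longleftrightarrow>
    (\<forall>j<k. \<forall>l<k. (\<Sum>i\<in>I. cnj (e l i) * e j i) = (if j = l then 1 else 0))"

text \<open>Parseval's identity: expanding the squared modulus leaves the Gram matrix, which is the
  identity. With I the positions of matrix entries, it equates norms of coordinate vectors with
  Hilbert--Schmidt norms.\<close>

lemma orthonormal_family_norm:
  assumes "orthonormal_family I k e"
  shows "(\<Sum>i\<in>I. (cmod (\<Sum>j<k. w j * e j i))\<^sup>2) = (\<Sum>j<k. (cmod (w j))\<^sup>2)"
proof -
  have "complex_of_real (\<Sum>i\<in>I. (cmod (\<Sum>j<k. w j * e j i))\<^sup>2)
      = (\<Sum>i\<in>I. (\<Sum>j<k. w j * e j i) * (\<Sum>l<k. cnj (w l) * cnj (e l i)))"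
    unfolding of_real_sum complex_norm_square by simp
  also have "\<dots> = (\<Sum>i\<in>I. \<Sum>j<k. \<Sum>l<k. w j * cnj (w l) * (cnj (e l i) * e j i))"
    by (simp add: sum_product mult_ac)
  also have "\<dots> = (\<Sum>j<k. \<Sum>i\<in>I. \<Sum>l<k. w j * cnj (w l) * (cnj (e l i) * e j i))"
    by (rule sum.swap)
  also have "\<dots> = (\<Sum>j<k. \<Sum>l<k. \<Sum>i\<in>I. w j * cnj (w l) * (cnj (e l i) * e j i))"
    by (intro sum.cong refl sum.swap)
  also have "\<dots> = (\<Sum>j<k. \<Sum>l<k. w j * cnj (w l) * (if j = l then 1 else 0))"
    using assms by (intro sum.cong refl) (simp add: sum_distrib_left[symmetric] orthonormal_family_def)
  also have "\<dots> = (\<Sum>j<k. w j * cnj (w j))"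
    by (intro sum.cong refl) (simp add: if_distrib cong: if_cong)
  also have "\<dots> = complex_of_real (\<Sum>j<k. (cmod (w j))\<^sup>2)"
    unfolding of_real_sum complex_norm_square ..
  finally show ?thesis by (simp only: of_real_eq_iff)
qed

text \<open>The orthogonal projection onto the span has trace k, while each of its diagonal entries
  is at most 1.\<close>

lemma orthonormal_family_card:
  assumes I: "finite I" and e: "orthonormal_family I k e"
  shows "k \<le> card I"
proof -
  \<comment> \<open>\<open>B i\<close> is both the squared norm and the i-th coordinate of the projection of the i-th unit vector.\<close>
  define B where "B i = (\<Sum>j<k. (cmod (e j i))\<^sup>2)" for i
  have B1: "B i \<le> 1" if "i \<in> I" for i
  proof -
    have "(\<Sum>j<k. cnj (e j i) * e j i) = complex_of_real (B i)"
      unfolding B_def of_real_sum complex_norm_square by (simp add: mult.commute)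
    then have "(B i)\<^sup>2 = (cmod (\<Sum>j<k. cnj (e j i) * e j i))\<^sup>2"
      by simp
    also have "\<dots> \<le> (\<Sum>i'\<in>I. (cmod (\<Sum>j<k. cnj (e j i) * e j i'))\<^sup>2)"
      by (rule member_le_sum[OF that _ I, where f = "\<lambda>i'. (cmod (\<Sum>j<k. cnj (e j i) * e j i'))\<^sup>2"]) simp
    also have "\<dots> = B i"
      by (simp add: orthonormal_family_norm[OF e] B_def)
    finally have "B i * B i \<le> B i * 1" by (simp add: power2_eq_square)
    moreover have "0 \<le> B i" by (simp add: B_def sum_nonneg)
    ultimately show ?thesis
      by (cases "B i = 0") auto
  qed
  have n: "(\<Sum>i\<in>I. (cmod (e j i))\<^sup>2) = 1" if "j < k" for j
  proof -
    have "complex_of_real (\<Sum>i\<in>I. (cmod (e j i))\<^sup>2) = (\<Sum>i\<in>I. cnj (e j i) * e j i)"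
      unfolding of_real_sum complex_norm_square by (simp add: mult.commute)
    also have "\<dots> = 1" using e that by (simp add: orthonormal_family_def)
    finally show ?thesis by (simp only: of_real_eq_1_iff)
  qed
  have "real k = (\<Sum>j<k. \<Sum>i\<in>I. (cmod (e j i))\<^sup>2)"
    by (simp add: n)
  also have "\<dots> = (\<Sum>i\<in>I. B i)"
    unfolding B_def by (rule sum.swap)
  also have "\<dots> \<le> (\<Sum>i\<in>I. 1)"
    by (intro sum_mono B1)
  finally show ?thesis by simp
qed

text \<open>Lengths of orthonormal families are bounded by \<open>card I\<close>, so a longest one
  exists in S. If some f in S had a nonzero residual g after projection, the normalised g would
  extend the family.\<close>

lemma orthonormal_basis_exists:
  assumes I: "finite I" and S: "\<And>f g c. f \<in> S \<Longrightarrow> g \<in> S \<Longrightarrow> (\<lambda>i. f i + c * g i) \<in> S"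
    and S0: "(\<lambda>i. 0) \<in> S"
  shows "\<exists>k e. (\<forall>j<k. e j \<in> S) \<and> orthonormal_family I k e \<and>
    (\<forall>f\<in>S. \<forall>i\<in>I. f i = (\<Sum>j<k. (\<Sum>i\<in>I. cnj (e j i) * f i) * e j i))"
proof -
  let ?P = "\<lambda>k. \<exists>e. (\<forall>j<k. e j \<in> S) \<and> orthonormal_family I k e"
  have P0: "?P 0" by (simp add: orthonormal_family_def)
  have bound: "\<forall>k. ?P k \<longrightarrow> k < Suc (card I)"
    unfolding less_Suc_eq_le by (intro allI impI, elim exE conjE, rule orthonormal_family_card[OF I])
  obtain k where "?P k \<and> (\<forall>k'. ?P k' \<longrightarrow> k' \<le> k)"
    using ex_has_greatest_nat[of ?P 0 "\<lambda>k. k", OF P0 bound] by (rule exE)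
  then have k: "?P k" and max: "\<forall>k'. ?P k' \<longrightarrow> k' \<le> k" by (rule conjunct1, rule conjunct2)
  obtain e where "\<forall>j<k. e j \<in> S" and e: "orthonormal_family I k e"
    using k by (elim exE conjE)
  then have eS: "e j \<in> S" if "j < k" for j using that by simp
  have "f i = (\<Sum>j<k. (\<Sum>i\<in>I. cnj (e j i) * f i) * e j i)" if f: "f \<in> S" and i: "i \<in> I" for f i
  proof -
    define a where "a j = (\<Sum>i\<in>I. cnj (e j i) * f i)" for j
    define g where "g i = f i - (\<Sum>j<k. a j * e j i)" for i
    \<comment> \<open>Stated for every l <= k so that the closure property of S can remove one term
      at a time.\<close>
    have "(\<lambda>i. f i - (\<Sum>j<l. a j * e j i)) \<in> S" if "l \<le> k" for l
      using that
    proof (induction l)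
      case 0
      then show ?case using f by simp
    next
      case (Suc l)
      then have "(\<lambda>i. (f i - (\<Sum>j<l. a j * e j i)) + (- a l) * e l i) \<in> S"
        by (intro S eS) auto
      then show ?case by (simp add: algebra_simps)
    qed
    then have gS: "g \<in> S" unfolding g_def[abs_def] by blast
    have orth: "(\<Sum>i\<in>I. cnj (e l i) * g i) = 0" if "l < k" for l
    proof -
      have "(\<Sum>i\<in>I. cnj (e l i) * g i) = a l - (\<Sum>i\<in>I. \<Sum>j<k. a j * (cnj (e l i) * e j i))"
        by (simp add: g_def a_def right_diff_distrib sum_subtractf sum_distrib_left mult_ac)
      also have "(\<Sum>i\<in>I. \<Sum>j<k. a j * (cnj (e l i) * e j i)) = (\<Sum>j<k. a j * (if j = l then 1 else 0))"
        using e that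
        by (subst sum.swap) (simp add: sum_distrib_left[symmetric] orthonormal_family_def)
      also have "\<dots> = a l"
        using that by (simp add: if_distrib cong: if_cong)
      finally show ?thesis by simp
    qed
    have "cl2 I g = 0"
    proof (rule ccontr)
      assume ne: "cl2 I g \<noteq> 0"
      define c where "c = complex_of_real (1 / cl2 I g)"
      define e' where "e' = e(k := (\<lambda>i. c * g i))"
      have "(\<lambda>i. 0 + c * g i) \<in> S" by (rule S[OF S0 gS])
      then have "\<forall>j<Suc k. e' j \<in> S"
        by (auto simp: e'_def less_Suc_eq eS)
      moreover have "orthonormal_family I (Suc k) e'"
        unfolding orthonormal_family_def
      proof (intro allI impI)
        fix j l assume jl: "j < Suc k" "l < Suc k"
        have gg: "(\<Sum>i\<in>I. cnj (g i) * g i) = complex_of_real ((cl2 I g)\<^sup>2)"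
          unfolding cl2_square of_real_sum complex_norm_square by (simp add: mult.commute)
        have kk: "(\<Sum>i\<in>I. cnj (c * g i) * (c * g i)) = 1"
        proof -
          have "(\<Sum>i\<in>I. cnj (c * g i) * (c * g i)) = cnj c * c * (\<Sum>i\<in>I. cnj (g i) * g i)"
            by (simp add: sum_distrib_left mult_ac)
          also have "\<dots> = 1"
            unfolding gg c_def using ne by (simp add: power2_eq_square)
          finally show ?thesis .
        qed
        have lk: "(\<Sum>i\<in>I. cnj (e l i) * (c * g i)) = 0" if "l < k" for l
          using orth[OF that] by (simp add: sum_distrib_left[symmetric] mult.left_commute)
        have kl: "(\<Sum>i\<in>I. cnj (c * g i) * e l i) = 0" if "l < k" for l
        proof -
          have "(\<Sum>i\<in>I. cnj (c * g i) * e l i) = cnj (\<Sum>i\<in>I. cnj (e l i) * (c * g i))"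
            by (simp add: mult_ac)
          then show ?thesis by (simp add: lk[OF that])
        qed
        show "(\<Sum>i\<in>I. cnj (e' l i) * e' j i) = (if j = l then 1 else 0)"
          using jl e kk lk kl by (auto simp: less_Suc_eq e'_def orthonormal_family_def)
      qed
      ultimately have "?P (Suc k)" by (intro exI[of _ e'] conjI)
      then have "Suc k \<le> k" by (rule max[rule_format])
      then show False by simp
    qed
    then have "g i = 0" using cl2_ge_entry[OF I i, of g] by simp
    then show ?thesis by (simp add: g_def a_def)
  qed
  then show ?thesis
    using eS e by (intro exI[of _ k] exI[of _ e] conjI ballI allI impI) auto
qed

text \<open>Only the unit ball has to be tested. This suits an estimate in which the whole
  construction depends on a vector v of norm at most 1.\<close>

lemma opnorm_leI:
  assumes "\<And>v. v \<in> carrier_vec (dim_col A) \<Longrightarrow> vnorm v \<le> 1 \<Longrightarrow> vnorm (A *\<^sub>v v) \<le> C"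
  shows "opnorm A \<le> C"
  unfolding opnorm_def
proof (rule cSup_least)
  show "{vnorm (A *\<^sub>v v) |v. v \<in> carrier_vec (dim_col A) \<and> vnorm v \<le> 1} \<noteq> {}"
    by (auto intro!: exI[of _ "0\<^sub>v (dim_col A)"])
qed (use assms in blast)

text \<open>Here \<open>y\<close> is left multiplication by \<open>M\<close> on the algebra generated by \<open>M\<close>, in a basis
  \<open>P j (M)\<close> that is orthonormal for the Hilbert--Schmidt inner product; orthonormality is what
  gives the norm bound. The \<open>\<alpha> l\<close> are the coordinates of the identity matrix.\<close>

lemma left_regular_point:
  assumes M: "M \<in> Md d"
  obtains y P \<alpha> where
    "y \<in> Md d" "\<forall>j<fst y. free_poly d (P j)"
    "\<forall>r s \<delta>. free_pmat d r s \<delta> \<longrightarrow> opnorm (pmat_eval r s \<delta> y) \<le> opnorm (pmat_eval r s \<delta> M)"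
    "\<forall>q. free_poly d q \<longrightarrow> (\<forall>i<fst M. \<forall>c<fst M. \<forall>j<fst y.
      (poly_eval q M * poly_eval (P j) M) $$ (i, c)
      = (\<Sum>l<fst y. poly_eval q y $$ (l, j) * poly_eval (P l) M $$ (i, c)))"
    "\<forall>i<fst M. \<forall>c<fst M. 1\<^sub>m (fst M) $$ (i, c) = (\<Sum>l<fst y. \<alpha> l * poly_eval (P l) M $$ (i, c))"
proof -
  define n where "n = fst M"
  let ?I = "{..<n} \<times> {..<n}"
  \<comment> \<open>The unital algebra generated by M, seen as a space of functions on the positions
    of matrix entries. Values elsewhere are unconstrained.\<close>
  define S :: "(nat \<times> nat \<Rightarrow> complex) set"
    where "S = {f. \<exists>p. free_poly d p \<and> (\<forall>x\<in>?I. f x = poly_eval p M $$ x)}"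
  have S_lin: "(\<lambda>x. f x + c * g x) \<in> S" if fg: "f \<in> S" "g \<in> S" for f g c
  proof -
    obtain p q where p: "free_poly d p" "\<forall>x\<in>?I. f x = poly_eval p M $$ x"
      and q: "free_poly d q" "\<forall>x\<in>?I. g x = poly_eval q M $$ x"
      using fg unfolding S_def by blast
    let ?r = "\<lambda>w. p w - (- c) * q w"
    have q': "free_poly d (\<lambda>w. (- c) * q w)" using q(1) by (rule free_poly_scale)
    have ev: "poly_eval ?r M = poly_eval p M - (- c) \<cdot>\<^sub>m poly_eval q M"
      by (simp only: poly_eval_diff[OF p(1) q'] poly_eval_scale[OF q(1)])
    have "\<forall>x\<in>?I. f x + c * g x = poly_eval ?r M $$ x"
    proof
      fix x assume x: "x \<in> ?I"
      obtain i j where ij: "x = (i, j)" "i < fst M" "j < fst M" using x n_def by auto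
      show "f x + c * g x = poly_eval ?r M $$ x"
        unfolding ev using p(2) q(2) x ij by simp
    qed
    moreover have "free_poly d ?r" using p(1) q' by (rule free_poly_diff)
    ultimately show ?thesis unfolding S_def by blast
  qed
  have S_0: "(\<lambda>x. 0) \<in> S"
    unfolding S_def n_def by (auto intro!: exI[of _ "\<lambda>w. 0"] free_poly_zero)
  have fin: "finite ?I" by simp
  have "\<exists>k e. (\<forall>j<k. e j \<in> S) \<and> orthonormal_family ?I k e \<and>
      (\<forall>f\<in>S. \<forall>x\<in>?I. f x = (\<Sum>j<k. (\<Sum>x\<in>?I. cnj (e j x) * f x) * e j x))"
    by (rule orthonormal_basis_exists[OF fin S_lin S_0])
  then obtain k e where eS: "\<forall>j<k. e j \<in> S" and on: "orthonormal_family ?I k e"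
    and ex': "\<forall>f\<in>S. \<forall>x\<in>?I. f x = (\<Sum>j<k. (\<Sum>x\<in>?I. cnj (e j x) * f x) * e j x)"
    by (elim exE conjE)
  note ex = ex'[rule_format]
  have "\<forall>j. \<exists>p. j < k \<longrightarrow> free_poly d p \<and> (\<forall>x\<in>?I. e j x = poly_eval p M $$ x)"
    using eS unfolding S_def by blast
  then obtain P where P: "\<And>j. j < k \<Longrightarrow> free_poly d (P j)"
    and eP: "\<And>j x. j < k \<Longrightarrow> x \<in> ?I \<Longrightarrow> e j x = poly_eval (P j) M $$ x"
    by (metis choice)
  define coef where "coef g l = (\<Sum>x\<in>?I. cnj (e l x) * g x)" for g l
  \<comment> \<open>Column j of the i-th matrix lists the Hilbert--Schmidt coordinates of M_i
    P_j(M).\<close>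
  define y :: point where "y = (k, map (\<lambda>i. mat k k (\<lambda>(l, j).
      coef (\<lambda>x. (snd M ! i * poly_eval (P j) M) $$ x) l)) [0..<d])"
  have polyS: "(\<lambda>x. poly_eval p M $$ x) \<in> S" if "free_poly d p" for p
    using that unfolding S_def by blast
  have unit: "1\<^sub>m n $$ (i, c) = (\<Sum>l<k. coef (\<lambda>x. poly_eval (word_poly []) M $$ x) l * poly_eval (P l) M $$ (i, c))"
    if ic: "i < n" "c < n" for i c
  proof -
    have x: "(i, c) \<in> ?I" using ic by simp
    have "1\<^sub>m n $$ (i, c) = poly_eval (word_poly []) M $$ (i, c)"
      using poly_eval_word[OF M, of "[]"] by (simp add: n_def)
    also have "\<dots> = (\<Sum>l<k. coef (\<lambda>x. poly_eval (word_poly []) M $$ x) l * e l (i, c))"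
      using ex[OF polyS[OF free_poly_word] x, of "[]"] by (simp add: coef_def)
    also have "\<dots> = (\<Sum>l<k. coef (\<lambda>x. poly_eval (word_poly []) M $$ x) l * poly_eval (P l) M $$ (i, c))"
      by (intro sum.cong refl) (simp add: eP[OF _ x])
    finally show ?thesis .
  qed
  have n: "0 < n" using M by (simp add: Md_iff n_def)
  \<comment> \<open>\<open>Md\<close> demands a positive dimension. An empty basis would make the
    diagonal entries of the identity matrix empty sums.\<close>
  have k: "0 < k"
  proof (rule ccontr)
    assume "\<not> 0 < k"
    then show False using unit[OF n n] n by simp
  qed
  have y: "y \<in> Md d" and fy: "fst y = k" using k by (auto simp: Md_iff y_def)
  \<comment> \<open>The product M_i P_j(M) is again the value of a polynomial, so the basis
    expansion applies, and its coefficients are column j of y_i by construction.\<close>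
  have gen: "(snd M ! i * poly_eval (P j) M) $$ (a, c) = (\<Sum>l<k. snd y ! i $$ (l, j) * poly_eval (P l) M $$ (a, c))"
    if *: "i < d" "j < k" "a < n" "c < n" for i j a c
  proof -
    have x: "(a, c) \<in> ?I" using * by simp
    have w: "free_poly d (word_poly [i])" using *(1) by (intro free_poly_word) simp
    have Mi: "snd M ! i \<in> carrier_mat (fst M) (fst M)" using M *(1) by (simp add: Md_iff)
    have m: "poly_eval (poly_mult (word_poly [i]) (P j)) M = snd M ! i * poly_eval (P j) M"
      using poly_eval_word[OF M, of "[i]"] Mi *(1) by (simp add: poly_eval_mult[OF M w P[OF *(2)]])
    have "(\<lambda>x. (snd M ! i * poly_eval (P j) M) $$ x) \<in> S"
      using polyS[OF free_poly_mult[OF w P[OF *(2)]]] unfolding m .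
    from ex[OF this x] show ?thesis
      using * by (simp add: y_def coef_def[symmetric] eP[OF _ x])
  qed
  have expand: "(poly_eval q M * poly_eval (P j) M) $$ (i, c) = (\<Sum>l<k. poly_eval q y $$ (l, j) * poly_eval (P l) M $$ (i, c))"
    if q: "free_poly d q" and ic: "i < n" "c < n" and j: "j < k" for q i j c
  proof -
    \<comment> \<open>With c fixed, column l of V is column c of P_l(M). By \<open>gen\<close> this
      V intertwines M and y, which carries the expansion from the generators to every q.\<close>
    define V where "V = mat n k (\<lambda>(a, l). poly_eval (P l) M $$ (a, c))"
    have V: "V \<in> carrier_mat (fst M) (fst y)" by (simp add: V_def fy n_def)
    have XV: "(X * V) $$ (a, l) = (X * poly_eval (P l) M) $$ (a, c)"
      if X: "X \<in> carrier_mat (fst M) (fst M)" and al: "a < n" "l < k" for X a l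
    proof -
      have "(X * V) $$ (a, l) = (\<Sum>b<fst M. X $$ (a, b) * V $$ (b, l))"
        using al by (intro index_mult_mat_sum[OF X V]) (auto simp: n_def fy)
      also have "\<dots> = (\<Sum>b<fst M. X $$ (a, b) * poly_eval (P l) M $$ (b, c))"
        using al by (intro sum.cong refl) (simp add: V_def n_def)
      also have "\<dots> = (X * poly_eval (P l) M) $$ (a, c)"
        using al ic by (intro index_mult_mat_sum[symmetric, OF X poly_eval_carrier]) (auto simp: n_def)
      finally show ?thesis .
    qed
    have VY: "(V * Y) $$ (a, l) = (\<Sum>b<k. Y $$ (b, l) * poly_eval (P b) M $$ (a, c))"
      if Y: "Y \<in> carrier_mat (fst y) (fst y)" and al: "a < n" "l < k" for Y a l
    proof -
      have "(V * Y) $$ (a, l) = (\<Sum>b<fst y. V $$ (a, b) * Y $$ (b, l))"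
        using al by (intro index_mult_mat_sum[OF V Y]) (auto simp: n_def fy)
      also have "\<dots> = (\<Sum>b<k. Y $$ (b, l) * poly_eval (P b) M $$ (a, c))"
        unfolding fy using al by (intro sum.cong refl) (simp add: V_def mult.commute)
      finally show ?thesis .
    qed
    have "poly_eval q M * V = V * poly_eval q y"
    proof (rule poly_eval_intertwine[OF M y V _ q])
      fix i' assume i': "i' < d"
      have c1: "snd M ! i' \<in> carrier_mat (fst M) (fst M)" "snd y ! i' \<in> carrier_mat (fst y) (fst y)"
        using M y i' by (auto simp: Md_iff)
      show "snd M ! i' * V = V * snd y ! i'"
      proof (rule eq_matI)
        fix a l assume "a < dim_row (V * snd y ! i')" "l < dim_col (V * snd y ! i')"
        then have al: "a < n" "l < k" using V c1 by (auto simp: n_def fy)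
        then show "(snd M ! i' * V) $$ (a, l) = (V * snd y ! i') $$ (a, l)"
          using i' ic by (simp only: XV[OF c1(1)] VY[OF c1(2)] gen)
      qed (use V c1 in auto)
    qed
    then show ?thesis
      using XV[OF poly_eval_carrier[of q M] ic(1) j] VY[OF poly_eval_carrier[of q y] ic(1) j] by metis
  qed
  have norm: "opnorm (pmat_eval r s \<delta> y) \<le> opnorm (pmat_eval r s \<delta> M)" if \<delta>: "free_pmat d r s \<delta>" for r s \<delta>
  proof -
    let ?C = "opnorm (pmat_eval r s \<delta> M)"
    have "kernel_bound ({..<r} \<times> {..<k}) ({..<s} \<times> {..<k}) (\<lambda>(a, i) (b, j). poly_eval (\<delta> a b) y $$ (i, j)) ?C"
      unfolding kernel_bound_def
    proof
      fix f :: "nat \<times> nat \<Rightarrow> complex"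
      \<comment> \<open>The vector f consists of one coordinate vector for each b, and W b is the
        matrix with these coordinates; g a lists the coordinates of the a-th block of \<delta>(y)
        f.\<close>
      define W where "W b x = (\<Sum>j<k. f (b, j) * e j x)" for b x
      define g where "g a l = (\<Sum>b<s. \<Sum>j<k. poly_eval (\<delta> a b) y $$ (l, j) * f (b, j))" for a l
      have col: "(\<Sum>b<s. \<Sum>l<n. poly_eval (\<delta> a b) M $$ (i, l) * W b (l, c)) = (\<Sum>l<k. g a l * e l (i, c))"
        if a: "a < r" and ic: "i < n" "c < n" for a i c
      proof -
        have "(\<Sum>l<n. poly_eval (\<delta> a b) M $$ (i, l) * W b (l, c))
            = (\<Sum>l<k. (\<Sum>j<k. poly_eval (\<delta> a b) y $$ (l, j) * f (b, j)) * e l (i, c))" if b: "b < s" for b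
        proof -
          have d: "free_poly d (\<delta> a b)" using \<delta> a b by (simp add: free_pmat_def)
          have "(\<Sum>l<n. poly_eval (\<delta> a b) M $$ (i, l) * W b (l, c))
              = (\<Sum>l<n. \<Sum>j<k. f (b, j) * (poly_eval (\<delta> a b) M $$ (i, l) * poly_eval (P j) M $$ (l, c)))"
            unfolding W_def sum_distrib_left
            by (intro sum.cong refl) (use ic in \<open>simp add: eP mult_ac\<close>)
          also have "\<dots> = (\<Sum>j<k. f (b, j) * (\<Sum>l<n. poly_eval (\<delta> a b) M $$ (i, l) * poly_eval (P j) M $$ (l, c)))"
            by (subst sum.swap) (simp add: sum_distrib_left)
          also have "\<dots> = (\<Sum>j<k. f (b, j) * (poly_eval (\<delta> a b) M * poly_eval (P j) M) $$ (i, c))"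
            using ic by (simp only: index_mult_mat_sum[OF poly_eval_carrier poly_eval_carrier] n_def)
          also have "\<dots> = (\<Sum>j<k. \<Sum>l<k. f (b, j) * (poly_eval (\<delta> a b) y $$ (l, j) * e l (i, c)))"
            unfolding sum_distrib_left[symmetric]
            by (intro sum.cong refl) (use ic in \<open>simp add: expand[OF d ic] eP\<close>)
          also have "\<dots> = (\<Sum>l<k. (\<Sum>j<k. poly_eval (\<delta> a b) y $$ (l, j) * f (b, j)) * e l (i, c))"
            by (subst sum.swap) (simp add: sum_distrib_left mult_ac)
          finally show ?thesis .
        qed
        then have "(\<Sum>b<s. \<Sum>l<n. poly_eval (\<delta> a b) M $$ (i, l) * W b (l, c))
            = (\<Sum>b<s. \<Sum>l<k. (\<Sum>j<k. poly_eval (\<delta> a b) y $$ (l, j) * f (b, j)) * e l (i, c))"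
          by simp
        also have "\<dots> = (\<Sum>l<k. g a l * e l (i, c))"
          unfolding g_def by (subst sum.swap) (simp add: sum_distrib_right)
        finally show ?thesis .
      qed
      \<comment> \<open>For fixed c the columns form an ordinary vector on which \<delta>(M) acts,
        so its operator norm applies. Summing over c gives the same bound in the Hilbert--Schmidt
        norm.\<close>
      have cols: "(\<Sum>a<r. \<Sum>i<n. (cmod (\<Sum>l<k. g a l * e l (i, c)))\<^sup>2) \<le> ?C\<^sup>2 * (\<Sum>b<s. \<Sum>l<n. (cmod (W b (l, c)))\<^sup>2)"
        if c: "c < n" for c
      proof -
        let ?h = "\<lambda>(b, l). W b (l, c)"
        have "cl2 ({..<r} \<times> {..<n}) (\<lambda>p. \<Sum>q\<in>{..<s} \<times> {..<n}.
            (\<lambda>(a, i) (b, j). poly_eval (\<delta> a b) M $$ (i, j)) p q * ?h q) \<le> ?C * cl2 ({..<s} \<times> {..<n}) ?h"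
          unfolding n_def by (rule kernel_boundD[OF pmat_kernel_bound])
        also have "cl2 ({..<r} \<times> {..<n}) (\<lambda>p. \<Sum>q\<in>{..<s} \<times> {..<n}.
            (\<lambda>(a, i) (b, j). poly_eval (\<delta> a b) M $$ (i, j)) p q * ?h q)
          = cl2 ({..<r} \<times> {..<n}) (\<lambda>(a, i). \<Sum>l<k. g a l * e l (i, c))"
          using c by (intro cl2_cong refl)
            (auto simp: col[symmetric] sum.cartesian_product split_beta)
        finally have "(cl2 ({..<r} \<times> {..<n}) (\<lambda>(a, i). \<Sum>l<k. g a l * e l (i, c)))\<^sup>2 \<le> (?C * cl2 ({..<s} \<times> {..<n}) ?h)\<^sup>2"
          by (intro power_mono) auto
        then show ?thesis
          unfolding power_mult_distrib cl2_square by (simp add: sum.cartesian_product split_beta)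
      qed
      have swap: "(\<Sum>c<n. \<Sum>a<m. \<Sum>i<n. h a (i, c)) = (\<Sum>a<m. \<Sum>x\<in>?I. h a x)"
        for m :: nat and h :: "nat \<Rightarrow> nat \<times> nat \<Rightarrow> real"
      proof -
        have "(\<Sum>c<n. \<Sum>a<m. \<Sum>i<n. h a (i, c)) = (\<Sum>a<m. \<Sum>c<n. \<Sum>i<n. h a (i, c))"
          by (rule sum.swap)
        also have "\<dots> = (\<Sum>a<m. \<Sum>i<n. \<Sum>c<n. h a (i, c))"
          by (intro sum.cong refl sum.swap)
        finally show ?thesis by (simp add: sum.cartesian_product split_beta)
      qed
      \<comment> \<open>Orthonormality exchanges coordinates for matrix entries at both ends of this
        chain; in between the entries are regrouped by columns.\<close>
      have "(\<Sum>a<r. \<Sum>l<k. (cmod (g a l))\<^sup>2) = (\<Sum>a<r. \<Sum>x\<in>?I. (cmod (\<Sum>l<k. g a l * e l x))\<^sup>2)"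
        by (simp only: orthonormal_family_norm[OF on])
      also have "\<dots> = (\<Sum>c<n. \<Sum>a<r. \<Sum>i<n. (cmod (\<Sum>l<k. g a l * e l (i, c)))\<^sup>2)"
        by (rule swap[symmetric])
      also have "\<dots> \<le> (\<Sum>c<n. ?C\<^sup>2 * (\<Sum>b<s. \<Sum>l<n. (cmod (W b (l, c)))\<^sup>2))"
        by (intro sum_mono cols) simp
      also have "\<dots> = ?C\<^sup>2 * (\<Sum>b<s. \<Sum>x\<in>?I. (cmod (W b x))\<^sup>2)"
        by (simp only: sum_distrib_left[symmetric] swap[of "\<lambda>b x. (cmod (W b x))\<^sup>2" s])
      also have "\<dots> = ?C\<^sup>2 * (\<Sum>b<s. \<Sum>j<k. (cmod (f (b, j)))\<^sup>2)"
        unfolding W_def by (simp only: orthonormal_family_norm[OF on])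
      finally have "(cl2 ({..<r} \<times> {..<k}) (\<lambda>(a, l). g a l))\<^sup>2 \<le> (?C * cl2 ({..<s} \<times> {..<k}) f)\<^sup>2"
        unfolding power_mult_distrib cl2_square by (simp add: sum.cartesian_product split_beta)
      then have "cl2 ({..<r} \<times> {..<k}) (\<lambda>(a, l). g a l) \<le> ?C * cl2 ({..<s} \<times> {..<k}) f"
        by (rule power2_le_imp_le) simp
      moreover have "(\<lambda>p. \<Sum>q\<in>{..<s} \<times> {..<k}. (\<lambda>(a, i) (b, j). poly_eval (\<delta> a b) y $$ (i, j)) p q * f q)
          = (\<lambda>(a, l). g a l)"
        by (auto simp: g_def sum.cartesian_product split_beta)
      ultimately show "cl2 ({..<r} \<times> {..<k}) (\<lambda>p. \<Sum>q\<in>{..<s} \<times> {..<k}.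
          (\<lambda>(a, i) (b, j). poly_eval (\<delta> a b) y $$ (i, j)) p q * f q) \<le> ?C * cl2 ({..<s} \<times> {..<k}) f"
        by simp
    qed
    then show ?thesis
      by (intro iffD2[OF opnorm_pmat_eval_le_iff]) (simp_all only: fy opnorm_nonneg)
  qed
  show ?thesis
    by (rule that[OF y, unfolded fy, of P "coef (\<lambda>x. poly_eval (word_poly []) M $$ x)"])
      (use P norm expand unit in \<open>simp_all add: n_def\<close>)
qed

section \<open>Free holomorphic functions are locally approximable\<close>

text \<open>The corner is a compression. This is how a bound on \<phi> at the conjugated point
  becomes a bound on the intertwining defect.\<close>

lemma opnorm_corner_le:
  assumes A: "A \<in> carrier_mat m m" and B: "B \<in> carrier_mat m k" and C: "C \<in> carrier_mat k m"
    and D: "D \<in> carrier_mat k k"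
  shows "opnorm B \<le> opnorm (four_block_mat A B C D)"
proof -
  let ?X = "four_block_mat A B C D"
  have "kernel_bound {..<m + k} {..<m + k} (\<lambda>i j. ?X $$ (i, j)) (opnorm ?X)"
    using A D by (intro opnorm_kernel_bound) auto
  then have "kernel_bound ((\<lambda>i. i) ` {..<m}) ((\<lambda>j. m + j) ` {..<k}) (\<lambda>i j. ?X $$ (i, j)) (opnorm ?X)"
    by (rule kernel_bound_subset) auto
  then have "kernel_bound {..<m} {..<k} (\<lambda>i j. ?X $$ (i, m + j)) (opnorm ?X)"
    by (subst (asm) kernel_bound_reindex) auto
  then have "kernel_bound {..<m} {..<k} (\<lambda>i j. B $$ (i, j)) (opnorm ?X)"
    by (rule kernel_bound_cong[THEN iffD1, rotated]) (use A B C D in auto)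
  then show ?thesis
    using B by (subst opnorm_le_iff_kernel_bound) auto
qed

text \<open>Conjugating \<open>x \<oplus> y\<close> by the unipotent matrix with corner \<open>L\<close> stays inside \<open>G \<delta>\<close>, and the
  commutator appears in the corner of the value of \<open>\<phi>\<close> there.\<close>

lemma nc_intertwine_bound:
  assumes \<delta>: "free_pmat d r s \<delta>" and nc: "nc_function_on (G d r s \<delta>) \<phi>"
    and B: "\<And>x. x \<in> G d r s \<delta> \<Longrightarrow> opnorm (\<phi> x) \<le> B"
    and x: "x \<in> Md d" "opnorm (pmat_eval r s \<delta> x) \<le> t"
    and y: "y \<in> Md d" "opnorm (pmat_eval r s \<delta> y) \<le> t"
    and L: "L \<in> carrier_mat (fst x) (fst y)"
    and \<eta>: "0 \<le> \<eta>" "t + \<eta> < 1"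
    and off: "kernel_bound ({..<r} \<times> {..<fst x}) ({..<s} \<times> {..<fst y})
      (\<lambda>(a, i) (b, j). (poly_eval (\<delta> a b) x * L - L * poly_eval (\<delta> a b) y) $$ (i, j)) \<eta>"
  shows "opnorm (\<phi> x * L - L * \<phi> y) \<le> B"
proof -
  let ?m = "fst x" and ?k = "fst y"
  let ?S = "four_block_mat (1\<^sub>m ?m) L (0\<^sub>m ?k ?m) (1\<^sub>m ?k)"
  let ?T = "four_block_mat (1\<^sub>m ?m) (- L) (0\<^sub>m ?k ?m) (1\<^sub>m ?k)"
  define z where "z = conj_pt ?T ?S (dsum x y)"
  have G: "x \<in> G d r s \<delta>" "y \<in> G d r s \<delta>"
    using x y \<eta> by (auto simp: G_def)
  have xy: "dsum x y \<in> G d r s \<delta>"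
    using G dsum_in_G_iff[OF x(1) y(1) \<delta>] by blast
  have S: "?S \<in> carrier_mat (fst (dsum x y)) (fst (dsum x y))"
    and T: "?T \<in> carrier_mat (fst (dsum x y)) (fst (dsum x y))" by auto
  have ST: "?S * ?T = 1\<^sub>m (fst (dsum x y))" "?T * ?S = 1\<^sub>m (fst (dsum x y))"
    unfolding fst_dsum by (rule unipotent_inverse[OF L])+
  have xyM: "dsum x y \<in> Md d" using x(1) y(1) by (rule dsum_in_Md)
  have zM: "z \<in> Md d" unfolding z_def by (rule conj_pt_in_Md[OF xyM S T])
  have ev: "poly_eval (\<delta> a b) z = four_block_mat (poly_eval (\<delta> a b) x)
      (poly_eval (\<delta> a b) x * L - L * poly_eval (\<delta> a b) y) (0\<^sub>m ?k ?m) (poly_eval (\<delta> a b) y)"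
    if "a < r" "b < s" for a b
  proof -
    have p: "free_poly d (\<delta> a b)" using \<delta> that by (simp add: free_pmat_def)
    show ?thesis
      unfolding z_def poly_eval_conj[OF xyM S T ST p] poly_eval_dsum[OF x(1) y(1) p]
      by (rule conj_dsum_upper[OF poly_eval_carrier poly_eval_carrier L])
  qed
  \<comment> \<open>By \<open>ev\<close> each entry of \<delta> at z is block upper triangular: the
    diagonal parts assemble to \<delta>(x) and \<delta>(y), both of norm at most t, and the corners
    have joint norm at most \<eta>.\<close>
  have "opnorm (pmat_eval r s \<delta> z) \<le> t + \<eta>"
  proof (rule opnorm_pmat_block_upper[OF _ ev _ x(2) y(2) \<eta>(1) off])
    show "fst z = ?m + ?k" by (simp add: z_def)
    show "poly_eval (\<delta> a b) x * L - L * poly_eval (\<delta> a b) y \<in> carrier_mat ?m ?k" for a b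
      using mult_carrier_mat[OF L poly_eval_carrier] by (rule minus_carrier_mat)
  qed
  then have zG: "z \<in> G d r s \<delta>" using zM \<eta> by (simp add: G_def)
  have c: "\<phi> x \<in> carrier_mat ?m ?m" "\<phi> y \<in> carrier_mat ?k ?k"
    using nc G unfolding nc_function_on_def graded_on_def by blast+
  have "\<phi> z = ?T * \<phi> (dsum x y) * ?S"
    using nc xy S T ST zG unfolding nc_function_on_def z_def by blast
  also have "\<phi> (dsum x y) = dsum_mat (\<phi> x) (\<phi> y)"
    using nc xy G unfolding nc_function_on_def by blast
  also have "?T * dsum_mat (\<phi> x) (\<phi> y) * ?S = four_block_mat (\<phi> x) (\<phi> x * L - L * \<phi> y) (0\<^sub>m ?k ?m) (\<phi> y)"
    by (rule conj_dsum_upper[OF c L])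
  finally have "opnorm (\<phi> x * L - L * \<phi> y) \<le> opnorm (\<phi> z)"
    using opnorm_corner_le[OF c(1) minus_carrier_mat[OF mult_carrier_mat[OF L c(2)]] zero_carrier_mat c(2)]
    by simp
  also have "\<dots> \<le> B" by (rule B[OF zG])
  finally show ?thesis .
qed

text \<open>A polynomial u with u(M) = 1 splits the error \<phi>(x) - p(x) into \<phi>(x) u(x) -
  p(x), controlled by the intertwining bound, and -\<phi>(x) (u(x) - 1), controlled by boundedness
  of \<phi> and smallness of u - 1 near M. Each part receives \<epsilon> / 4.\<close>

lemma free_holomorphic_imp_locally_approximable:
  assumes hol: "free_holomorphic d D \<phi>" and M: "M \<in> D" and \<epsilon>: "0 < \<epsilon>"
  shows "\<exists>U p. free_open d U \<and> M \<in> U \<and> free_poly d p \<and>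
    (SUP x\<in>U \<inter> D. ereal (opnorm (\<phi> x - poly_eval p x))) < ereal \<epsilon>"
proof -
  obtain r s \<delta> where \<delta>: "free_pmat d r s \<delta>" and MG: "M \<in> G d r s \<delta>"
    and nc: "nc_function_on (G d r s \<delta>) \<phi>" and bd: "bounded_on (G d r s \<delta>) \<phi>"
    using hol M unfolding free_holomorphic_def by blast
  obtain B where B: "\<And>x. x \<in> G d r s \<delta> \<Longrightarrow> opnorm (\<phi> x) \<le> B"
    using bd unfolding bounded_on_def by blast
  have B0: "0 \<le> B" using B[OF MG] opnorm_nonneg[of "\<phi> M"] by linarith
  have B1: "B + 1 \<noteq> 0" using B0 by linarith
  have MM: "M \<in> Md d" using MG by (simp add: G_def)
  have \<delta>p: "free_poly d (\<delta> a b)" if "a < r" "b < s" for a b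
    using \<delta> that by (simp add: free_pmat_def)
  have M1: "opnorm (pmat_eval r s \<delta> M) < 1" using MG by (simp add: G_def)
  \<comment> \<open>The gap 1 - t is the room left for the corner in
    \<open>nc_intertwine_bound\<close>, the same for all x in the neighbourhood.\<close>
  obtain t where t: "opnorm (pmat_eval r s \<delta> M) < t" "t < 1"
    using dense[OF M1] by blast
  have t0: "0 < t" using t(1) opnorm_nonneg[of "pmat_eval r s \<delta> M"] by linarith
  obtain y P \<alpha> where y: "y \<in> Md d" and P': "\<forall>j<fst y. free_poly d (P j)"
    and ynorm: "\<forall>r s \<delta>. free_pmat d r s \<delta> \<longrightarrow> opnorm (pmat_eval r s \<delta> y) \<le> opnorm (pmat_eval r s \<delta> M)"
    and rep: "\<forall>q. free_poly d q \<longrightarrow> (\<forall>i<fst M. \<forall>c<fst M. \<forall>j<fst y.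
      (poly_eval q M * poly_eval (P j) M) $$ (i, c)
      = (\<Sum>l<fst y. poly_eval q y $$ (l, j) * poly_eval (P l) M $$ (i, c)))"
    and unit: "\<forall>i<fst M. \<forall>c<fst M. 1\<^sub>m (fst M) $$ (i, c) = (\<Sum>l<fst y. \<alpha> l * poly_eval (P l) M $$ (i, c))"
    by (rule left_regular_point[OF MM])
  define k where "k = fst y"
  have P: "free_poly d (P j)" if "j < k" for j using P' that by (simp add: k_def)
  have P_lin: "poly_eval (\<lambda>w. \<Sum>l<k. \<gamma> l * P l w) x $$ (i, j) = (\<Sum>l<k. \<gamma> l * poly_eval (P l) x $$ (i, j))"
    if "i < fst x" "j < fst x" for \<gamma> x i j
    by (rule poly_eval_lincomb[OF P that])
  have yt: "opnorm (pmat_eval r s \<delta> y) \<le> t" using ynorm \<delta> t by (meson less_imp_le order_trans)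
  have yG: "y \<in> G d r s \<delta>" using y yt t by (simp add: G_def)
  have \<phi>y: "\<phi> y \<in> carrier_mat k k" using nc yG unfolding nc_function_on_def graded_on_def k_def by blast
  \<comment> \<open>\<open>av\<close> holds the coordinates of the identity matrix. The polynomial u
    has these coordinates, so u(M) = 1, while p has the coordinates \<phi>(y) av.\<close>
  define av where "av = vec k \<alpha>"
  define \<beta> where "\<beta> l = (\<phi> y *\<^sub>v av) $ l" for l
  define u where "u = (\<lambda>w. \<Sum>l<k. \<alpha> l * P l w)"
  define p where "p = (\<lambda>w. \<Sum>l<k. \<beta> l * P l w)"
  define u1 where "u1 = (\<lambda>w. u w - word_poly [] w)"
  \<comment> \<open>\<open>R a b j\<close> agrees at M with the product of the (a, b) entry of
    \<delta> and P_j, by the expansion in the basis. Hence \<open>q a b j\<close> vanishes at M;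
    elsewhere it measures the failure of y to represent multiplication.\<close>
  define R where "R a b j = (\<lambda>w. \<Sum>l<k. poly_eval (\<delta> a b) y $$ (l, j) * P l w)" for a b j
  define q where "q a b j = (\<lambda>w. poly_mult (\<delta> a b) (P j) w - R a b j w)" for a b j
  have u: "free_poly d u" and p: "free_poly d p" unfolding u_def p_def by (intro free_poly_lincomb P; assumption)+
  have one: "free_poly d (word_poly [])" by (rule free_poly_word) simp
  have u1: "free_poly d u1" unfolding u1_def by (intro free_poly_diff u one)
  have R: "free_poly d (R a b j)" for a b j unfolding R_def by (intro free_poly_lincomb P; assumption)
  have \<delta>P: "free_poly d (poly_mult (\<delta> a b) (P j))" if "a < r" "b < s" "j < k" for a b j
    using that by (intro free_poly_mult \<delta>p P)
  have q: "free_poly d (q a b j)" if "a < r" "b < s" "j < k" for a b j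
    unfolding q_def using that by (intro free_poly_diff R \<delta>P)
  have u1_ev: "poly_eval u1 x = poly_eval u x - 1\<^sub>m (fst x)" if "x \<in> Md d" for x
    unfolding u1_def poly_eval_diff[OF u one] using poly_eval_word[OF that, of "[]"] by simp
  have q_ev: "poly_eval (q a b j) x = poly_eval (\<delta> a b) x * poly_eval (P j) x - poly_eval (R a b j) x"
    if "x \<in> Md d" "a < r" "b < s" "j < k" for a b j x
    unfolding q_def poly_eval_diff[OF \<delta>P[OF that(2-4)] R]
    by (simp only: poly_eval_mult[OF that(1) \<delta>p[OF that(2,3)] P[OF that(4)]])
  have u1M: "poly_eval u1 M = 0\<^sub>m (fst M) (fst M)"
    unfolding u1_ev[OF MM] u_def using unit
    by (intro eq_matI) (auto simp: P_lin simp flip: k_def)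
  have qM: "poly_eval (q a b j) M = 0\<^sub>m (fst M) (fst M)" if abj: "a < r" "b < s" "j < k" for a b j
  proof (rule eq_matI)
    fix i c assume "i < dim_row (0\<^sub>m (fst M) (fst M))" "c < dim_col (0\<^sub>m (fst M) (fst M))"
    then have ic: "i < fst M" "c < fst M" by auto
    have "poly_eval (R a b j) M $$ (i, c) = (poly_eval (\<delta> a b) M * poly_eval (P j) M) $$ (i, c)"
      unfolding R_def
      using P_lin[OF ic] rep[rule_format, OF \<delta>p[OF abj(1,2)] ic abj(3)[unfolded k_def]]
      unfolding k_def by (rule trans[OF _ sym])
    then show "poly_eval (q a b j) M $$ (i, c) = 0\<^sub>m (fst M) (fst M) $$ (i, c)"
      unfolding q_ev[OF MM abj] using ic by simp
  qed auto
  \<comment> \<open>The factor c enters L but not the bound B on the defect, so undoing it divides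
    the error by c. This choice makes \<open>B * vnorm av / c\<close> at most \<epsilon> / 4, and
    the + 1 keeps c positive.\<close>
  define c where "c = 4 * (B * vnorm av) / \<epsilon> + 1"
  \<comment> \<open>The defect has s k columns, each made of r pieces of norm at most c
    \<eta>.\<close>
  define N where "N = real (s * k * r)"
  \<comment> \<open>The first term gives t + c N \<eta> < 1, the second B \<eta> <= \<epsilon> / 4.
    Adding 1 keeps both denominators positive.\<close>
  define \<eta> where "\<eta> = min ((1 - t) / (c * N + 1)) (\<epsilon> / 4 / (B + 1))"
  have c: "0 < c" and N: "0 \<le> N"
    unfolding c_def N_def using B0 \<epsilon> by (auto intro!: add_nonneg_pos divide_nonneg_pos)
  have cN: "0 < c * N + 1" using c N by (intro add_nonneg_pos) auto
  have \<eta>: "0 < \<eta>" unfolding \<eta>_def using cN t B0 \<epsilon> by auto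
  have "c * N * \<eta> \<le> c * N * ((1 - t) / (c * N + 1))"
    unfolding \<eta>_def using c N by (intro mult_left_mono) auto
  also have "\<dots> < 1 - t"
    using cN t by (simp add: field_simps)
  finally have \<eta>1: "t + c * N * \<eta> < 1" by simp
  have "B * \<eta> \<le> (B + 1) * (\<epsilon> / 4 / (B + 1))"
    using B0 \<eta> by (intro mult_mono) (auto simp: \<eta>_def)
  also have "\<dots> = \<epsilon> / 4"
    unfolding times_divide_eq_right[of "B + 1" "\<epsilon> / 4" "B + 1"] by (rule nonzero_mult_div_cancel_left[OF B1])
  finally have \<eta>2: "B * \<eta> \<le> \<epsilon> / 4" .
  have "4 * (B * vnorm av) \<le> c * \<epsilon>"
    unfolding c_def using \<epsilon> by (simp add: field_simps)
  then have c1: "B * vnorm av / c \<le> \<epsilon> / 4" using c by (simp add: field_simps)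
  \<comment> \<open>A finite set of polynomials vanishing at M, so that requiring them to be small
    defines a free neighbourhood of M.\<close>
  define Q where "Q = insert u1 ((\<lambda>(a, b, j). q a b j) ` ({..<r} \<times> {..<s} \<times> {..<k}))"
  define U where "U = {x \<in> Md d. opnorm (pmat_eval r s \<delta> x) < t} \<inter> {x \<in> Md d. \<forall>f\<in>Q. opnorm (poly_eval f x) < \<eta>}"
  have "is_basic_free_open d U"
    unfolding U_def
  proof (intro basic_free_open_Int basic_free_open_sublevel \<delta> t0 basic_free_open_polys \<eta>)
    show "finite Q" by (simp add: Q_def)
    show "free_poly d f" if "f \<in> Q" for f using that u1 q by (auto simp: Q_def)
  qed
  then have "free_open d U" by (rule basic_free_open_imp_open)
  moreover have "M \<in> U"
    using MM t(1) \<eta> by (auto simp: U_def Q_def u1M qM)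
  moreover have "opnorm (\<phi> x - poly_eval p x) \<le> \<epsilon> / 2" if xU: "x \<in> U" for x
  proof -
    define m where "m = fst x"
    have x: "x \<in> Md d" and xt: "opnorm (pmat_eval r s \<delta> x) \<le> t"
      and xu: "opnorm (poly_eval u1 x) < \<eta>"
      and xq: "\<And>a b j. a < r \<Longrightarrow> b < s \<Longrightarrow> j < k \<Longrightarrow> opnorm (poly_eval (q a b j) x) < \<eta>"
      using xU by (auto simp: U_def Q_def)
    have xG: "x \<in> G d r s \<delta>" using x xt t by (simp add: G_def)
    have \<phi>x: "\<phi> x \<in> carrier_mat m m" using nc xG unfolding nc_function_on_def graded_on_def m_def by blast
    have pc: "poly_eval f x \<in> carrier_mat m m" for f by (simp add: m_def)
    \<comment> \<open>Each v gets its own L, but the constants and U are already fixed. Since L has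
      k columns whatever the dimension of x, the estimate is uniform over all dimensions.\<close>
    have key: "vnorm ((\<phi> x * poly_eval u x - poly_eval p x) *\<^sub>v v) \<le> B * vnorm av / c"
      if v: "v \<in> carrier_vec m" "vnorm v \<le> 1" for v
    proof -
      define L where "L = mat m k (\<lambda>(i, j). complex_of_real c * (poly_eval (P j) x *\<^sub>v v) $ i)"
      have L: "L \<in> carrier_mat m k" by (simp add: L_def)
      have comb: "(poly_eval (\<lambda>w. \<Sum>l<k. \<gamma> l * P l w) x *\<^sub>v v) $ i = (\<Sum>l<k. \<gamma> l * (poly_eval (P l) x *\<^sub>v v) $ i)"
        if i: "i < m" for \<gamma> i
      proof -
        have "(poly_eval (\<lambda>w. \<Sum>l<k. \<gamma> l * P l w) x *\<^sub>v v) $ i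
            = (\<Sum>j<m. \<Sum>l<k. \<gamma> l * poly_eval (P l) x $$ (i, j) * v $ j)"
          using i v by (simp add: m_def scalar_prod_def atLeast0LessThan P_lin sum_distrib_right)
        also have "\<dots> = (\<Sum>l<k. \<gamma> l * (\<Sum>j<m. poly_eval (P l) x $$ (i, j) * v $ j))"
          by (subst sum.swap) (simp add: sum_distrib_left mult.assoc)
        also have "\<dots> = (\<Sum>l<k. \<gamma> l * (poly_eval (P l) x *\<^sub>v v) $ i)"
          using i v by (simp add: m_def scalar_prod_def atLeast0LessThan)
        finally show ?thesis .
      qed
      \<comment> \<open>L turns linear combinations of coordinates into the same combinations of the
        polynomials P_l, evaluated at x and applied to v.\<close>
      have Lw: "(L *\<^sub>v w) $ i = complex_of_real c * (poly_eval (\<lambda>f. \<Sum>l<k. w $ l * P l f) x *\<^sub>v v) $ i"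
        if i: "i < m" and w: "w \<in> carrier_vec k" for w i
        unfolding comb[OF i] using i w
        by (simp add: L_def scalar_prod_def atLeast0LessThan sum_distrib_left mult_ac)
      \<comment> \<open>Left multiplication by the value at x gives the product with P_j, while the
        value at y recombines the columns of L into \<open>R a b j\<close>; their difference is
        \<open>q a b j\<close>.\<close>
      have Z: "(poly_eval (\<delta> a b) x * L - L * poly_eval (\<delta> a b) y) $$ (i, j)
          = complex_of_real c * (poly_eval (q a b j) x *\<^sub>v v) $ i"
        if abj: "a < r" "b < s" "j < k" and i: "i < m" for a b i j
      proof -
        have "(poly_eval (\<delta> a b) x * L) $$ (i, j)
            = (\<Sum>l<m. poly_eval (\<delta> a b) x $$ (i, l) * (complex_of_real c * (poly_eval (P j) x *\<^sub>v v) $ l))"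
          using abj i by (subst index_mult_mat_sum[OF pc L]) (auto simp: L_def)
        also have "\<dots> = complex_of_real c * (poly_eval (\<delta> a b) x *\<^sub>v (poly_eval (P j) x *\<^sub>v v)) $ i"
          using i v by (simp add: m_def scalar_prod_def atLeast0LessThan sum_distrib_left mult_ac)
        also have "poly_eval (\<delta> a b) x *\<^sub>v (poly_eval (P j) x *\<^sub>v v) = poly_eval (\<delta> a b) x * poly_eval (P j) x *\<^sub>v v"
          by (rule assoc_mult_mat_vec[symmetric, OF pc pc v(1)])
        finally have 1: "(poly_eval (\<delta> a b) x * L) $$ (i, j)
            = complex_of_real c * (poly_eval (\<delta> a b) x * poly_eval (P j) x *\<^sub>v v) $ i" .
        have "(L * poly_eval (\<delta> a b) y) $$ (i, j) = (\<Sum>l<k. L $$ (i, l) * poly_eval (\<delta> a b) y $$ (l, j))"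
          using abj i L by (intro index_mult_mat_sum) (auto simp: k_def)
        also have "\<dots> = complex_of_real c * (poly_eval (R a b j) x *\<^sub>v v) $ i"
          unfolding R_def comb[OF i] using i by (simp add: L_def sum_distrib_left mult_ac)
        finally have 2: "(L * poly_eval (\<delta> a b) y) $$ (i, j) = complex_of_real c * (poly_eval (R a b j) x *\<^sub>v v) $ i" .
        have "poly_eval (q a b j) x *\<^sub>v v = poly_eval (\<delta> a b) x * poly_eval (P j) x *\<^sub>v v - poly_eval (R a b j) x *\<^sub>v v"
          unfolding q_ev[OF x abj] by (rule minus_mult_distrib_mat_vec[OF mult_carrier_mat[OF pc pc] pc v(1)])
        then have "(poly_eval (q a b j) x *\<^sub>v v) $ i
            = (poly_eval (\<delta> a b) x * poly_eval (P j) x *\<^sub>v v) $ i - (poly_eval (R a b j) x *\<^sub>v v) $ i"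
          using i by (simp add: m_def)
        moreover have "(poly_eval (\<delta> a b) x * L - L * poly_eval (\<delta> a b) y) $$ (i, j)
            = (poly_eval (\<delta> a b) x * L) $$ (i, j) - (L * poly_eval (\<delta> a b) y) $$ (i, j)"
          using i abj(3) L by (simp add: k_def del: index_mult_mat(1))
        ultimately show ?thesis by (simp only: 1 2 right_diff_distrib)
      qed
      have col: "cl2 ({..<r} \<times> {..<m}) (\<lambda>(a, i). (poly_eval (\<delta> a b) x * L - L * poly_eval (\<delta> a b) y) $$ (i, j))
          \<le> real r * (c * \<eta>)" if bj: "b < s" "j < k" for b j
      proof -
        have "cl2 ({..<r} \<times> {..<m}) (\<lambda>(a, i). (poly_eval (\<delta> a b) x * L - L * poly_eval (\<delta> a b) y) $$ (i, j))
          \<le> (\<Sum>a<r. cl2 {..<m} (\<lambda>i. (poly_eval (\<delta> a b) x * L - L * poly_eval (\<delta> a b) y) $$ (i, j)))"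
          by (rule cl2_Times_le) simp
        also have "\<dots> \<le> (\<Sum>a<r. c * \<eta>)"
        proof (rule sum_mono)
          fix a assume "a \<in> {..<r}"
          then have a: "a < r" by simp
          have "cl2 {..<m} (\<lambda>i. (poly_eval (\<delta> a b) x * L - L * poly_eval (\<delta> a b) y) $$ (i, j))
              = cl2 {..<m} (\<lambda>i. complex_of_real c * (poly_eval (q a b j) x *\<^sub>v v) $ i)"
            by (intro cl2_cong refl) (simp only: lessThan_iff Z[OF a bj])
          also have "\<dots> = c * vnorm (poly_eval (q a b j) x *\<^sub>v v)"
            unfolding cl2_scale vnorm_cl2 using c by (simp add: m_def)
          also have "\<dots> \<le> c * (opnorm (poly_eval (q a b j) x) * vnorm v)"
            using c v by (intro mult_left_mono vnorm_le_opnorm) (auto simp: m_def)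
          also have "\<dots> \<le> c * (\<eta> * 1)"
            using c v xq[OF a bj] \<eta> by (intro mult_left_mono mult_mono) auto
          finally show "cl2 {..<m} (\<lambda>i. (poly_eval (\<delta> a b) x * L - L * poly_eval (\<delta> a b) y) $$ (i, j)) \<le> c * \<eta>"
            by simp
        qed
        finally show ?thesis by simp
      qed
      let ?Z = "\<lambda>(a, i) (b, j). (poly_eval (\<delta> a b) x * L - L * poly_eval (\<delta> a b) y) $$ (i, j)"
      have "(\<Sum>w\<in>{..<s} \<times> {..<k}. cl2 ({..<r} \<times> {..<m}) (\<lambda>p. ?Z p w)) \<le> (\<Sum>w\<in>{..<s} \<times> {..<k}. real r * (c * \<eta>))"
      proof (rule sum_mono)
        fix w assume "w \<in> {..<s} \<times> {..<k}"
        then obtain b j where w: "w = (b, j)" "b < s" "j < k" by auto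
        have "(\<lambda>p. ?Z p w) = (\<lambda>(a, i). (poly_eval (\<delta> a b) x * L - L * poly_eval (\<delta> a b) y) $$ (i, j))"
          by (rule ext) (simp only: w(1) split_beta fst_conv snd_conv)
        then show "cl2 ({..<r} \<times> {..<m}) (\<lambda>p. ?Z p w) \<le> real r * (c * \<eta>)"
          using col[OF w(2,3)] by simp
      qed
      also have "\<dots> = c * N * \<eta>" by (simp add: N_def)
      finally have off: "kernel_bound ({..<r} \<times> {..<m}) ({..<s} \<times> {..<k}) ?Z (c * N * \<eta>)"
        by (intro kernel_bound_mono[OF kernel_bound_columns]) auto
      have "opnorm (\<phi> x * L - L * \<phi> y) \<le> B"
        using L off c N \<eta> unfolding m_def k_def
        by (intro nc_intertwine_bound[OF \<delta> nc B x xt y yt _ _ \<eta>1]) auto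
      moreover have "vnorm ((\<phi> x * L - L * \<phi> y) *\<^sub>v av) \<le> opnorm (\<phi> x * L - L * \<phi> y) * vnorm av"
        using \<phi>y by (intro vnorm_le_opnorm) (auto simp: av_def)
      ultimately have le: "vnorm ((\<phi> x * L - L * \<phi> y) *\<^sub>v av) \<le> B * vnorm av"
        by (meson mult_right_mono order_trans vnorm_nonneg)
      have av: "av \<in> carrier_vec k" by (simp add: av_def)
      \<comment> \<open>On \<open>av\<close> the two terms of the defect become c \<phi>(x) u(x) v,
        treated here, and c p(x) v, treated in \<open>Lb\<close>.\<close>
      have Lav: "L *\<^sub>v av = complex_of_real c \<cdot>\<^sub>v (poly_eval u x *\<^sub>v v)"
      proof (rule eq_vecI)
        fix i assume "i < dim_vec (complex_of_real c \<cdot>\<^sub>v (poly_eval u x *\<^sub>v v))"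
        then have i: "i < m" by (simp add: m_def)
        have "(\<lambda>f. \<Sum>l<k. av $ l * P l f) = u" unfolding u_def by (rule ext) (simp add: av_def)
        then show "(L *\<^sub>v av) $ i = (complex_of_real c \<cdot>\<^sub>v (poly_eval u x *\<^sub>v v)) $ i"
          using Lw[OF i av] i by (simp add: m_def)
      qed (simp add: L_def m_def)
      have Lb: "L *\<^sub>v (\<phi> y *\<^sub>v av) = complex_of_real c \<cdot>\<^sub>v (poly_eval p x *\<^sub>v v)"
      proof (rule eq_vecI)
        fix i assume "i < dim_vec (complex_of_real c \<cdot>\<^sub>v (poly_eval p x *\<^sub>v v))"
        then have i: "i < m" by (simp add: m_def)
        have "(\<lambda>f. \<Sum>l<k. (\<phi> y *\<^sub>v av) $ l * P l f) = p" unfolding p_def \<beta>_def ..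
        then show "(L *\<^sub>v (\<phi> y *\<^sub>v av)) $ i = (complex_of_real c \<cdot>\<^sub>v (poly_eval p x *\<^sub>v v)) $ i"
          using Lw[OF i mult_mat_vec_carrier[OF \<phi>y av]] i by (simp add: m_def)
      qed (simp add: L_def m_def)
      let ?w1 = "poly_eval u x *\<^sub>v v" and ?w2 = "poly_eval p x *\<^sub>v v"
      have w: "?w1 \<in> carrier_vec m" "?w2 \<in> carrier_vec m"
        by (rule mult_mat_vec_carrier[OF pc v(1)])+
      have "(\<phi> x * L - L * \<phi> y) *\<^sub>v av = \<phi> x *\<^sub>v (L *\<^sub>v av) - L *\<^sub>v (\<phi> y *\<^sub>v av)"
        by (simp only: minus_mult_distrib_mat_vec[OF mult_carrier_mat[OF \<phi>x L] mult_carrier_mat[OF L \<phi>y] av]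
            assoc_mult_mat_vec[OF \<phi>x L av] assoc_mult_mat_vec[OF L \<phi>y av])
      also have "\<dots> = complex_of_real c \<cdot>\<^sub>v (\<phi> x *\<^sub>v ?w1) - complex_of_real c \<cdot>\<^sub>v ?w2"
        unfolding Lav Lb by (simp only: mult_mat_vec[OF \<phi>x w(1)])
      also have "\<dots> = complex_of_real c \<cdot>\<^sub>v (\<phi> x *\<^sub>v ?w1 - ?w2)"
        by (intro eq_vecI) (use w \<phi>x in \<open>auto simp: m_def right_diff_distrib simp del: index_mult_mat_vec\<close>)
      also have "\<phi> x *\<^sub>v ?w1 - ?w2 = (\<phi> x * poly_eval u x - poly_eval p x) *\<^sub>v v"
        by (simp only: minus_mult_distrib_mat_vec[OF mult_carrier_mat[OF \<phi>x pc] pc v(1)]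
            assoc_mult_mat_vec[OF \<phi>x pc v(1)])
      finally have "c * vnorm ((\<phi> x * poly_eval u x - poly_eval p x) *\<^sub>v v) \<le> B * vnorm av"
        using le c by (simp add: vnorm_smult)
      then show ?thesis using c by (simp add: field_simps)
    qed
    have E: "opnorm (\<phi> x * poly_eval u x - poly_eval p x) \<le> B * vnorm av / c"
      by (rule opnorm_leI) (use key in \<open>simp add: m_def\<close>)
    let ?E = "\<phi> x * poly_eval u x - poly_eval p x" and ?F = "\<phi> x * poly_eval u1 x"
    have Ec: "?E \<in> carrier_mat m m" by (rule minus_carrier_mat[OF pc])
    have Fc: "?F \<in> carrier_mat m m" by (rule mult_carrier_mat[OF \<phi>x pc])
    have "?F = \<phi> x * poly_eval u x - \<phi> x"
      unfolding u1_ev[OF x] m_def[symmetric]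
      using \<phi>x mult_minus_distrib_mat[OF \<phi>x pc one_carrier_mat] by simp
    then have "\<phi> x - poly_eval p x = ?E + - ?F"
      using \<phi>x pc[of u] pc[of p] by (intro eq_matI) auto
    then have "opnorm (\<phi> x - poly_eval p x) \<le> opnorm ?E + opnorm ?F"
      using opnorm_add[OF Ec uminus_carrier_mat[OF Fc]] by (simp add: opnorm_uminus)
    also have "\<dots> \<le> \<epsilon> / 4 + \<epsilon> / 4"
    proof (rule add_mono)
      show "opnorm ?E \<le> \<epsilon> / 4" using E c1 by (rule order_trans)
      have "opnorm ?F \<le> opnorm (\<phi> x) * opnorm (poly_eval u1 x)"
        by (rule opnorm_mult[OF \<phi>x pc])
      also have "\<dots> \<le> B * \<eta>"
        using xu B[OF xG] B0 by (intro mult_mono) auto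
      finally show "opnorm ?F \<le> \<epsilon> / 4" using \<eta>2 by (rule order_trans)
    qed
    finally show ?thesis by simp
  qed
  \<comment> \<open>A supremum inherits only a weak inequality; the bound \<epsilon> / 2 leaves room
    for the strict one.\<close>
  then have "(SUP x\<in>U \<inter> D. ereal (opnorm (\<phi> x - poly_eval p x))) \<le> ereal (\<epsilon> / 2)"
    by (intro SUP_least) auto
  then have "(SUP x\<in>U \<inter> D. ereal (opnorm (\<phi> x - poly_eval p x))) < ereal \<epsilon>"
    using \<epsilon> by (rule_tac order_le_less_trans) auto
  ultimately show ?thesis using p by blast
qed

theorem theorem9p8:
  fixes d :: nat and D :: "point set" and \<phi> :: "point \<Rightarrow> complex mat"
  assumes "free_open d D"
    and "graded_on D \<phi>"
  shows "free_holomorphic d D \<phi> \<longleftrightarrow>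
    (\<forall>M\<in>D. \<forall>\<epsilon>>0. \<exists>U p. free_open d U \<and> M \<in> U \<and> free_poly d p \<and>
       (SUP x\<in>U \<inter> D. ereal (opnorm (\<phi> x - poly_eval p x))) < ereal \<epsilon>)"
  using free_holomorphic_imp_locally_approximable locally_approximable_imp_free_holomorphic[OF assms]
  by blast

end
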